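(* Let $X$ be $C^{0,\alpha}[a,b]$ with $0<\alpha\le1$ or $W^{1,p}(a,b)$ with $1<p\le\infty$. Let $S_\Phi$ be the set of all measurable selectors of $\Phi$, and let $q\in[1,\infty)$. The set-valued mapping $G:X\rightrightarrows\mathcal{L}(X,L^q(a,b))$, $$G(u)=\{L:\ (Lh)(t)=\langle\mu(u,t),h\rangle,\ \mu\in S_\Phi\},$$ defines a Newton derivative of the cumulated maximum $F:X\to L^q(a,b)$, $(Fu)(t)=\max_{s\in[a,t]}u(s)$, and for every $u\in X$ $$\|F(u+h)-F(u)-Lh\|_{L^q}\le\rho_u^G(\|h\|_\infty)\,\|h\|_X$$ for all $h\in X$ and all $L\in G(u+h)$. Here $\rho_u^G:\mathbb{R}_+\to\mathbb{R}_+$ is an increasing function with $\rho_u^G(\delta)\to0$ as $\delta\to0$, bounded independently of $u$.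
   Context: Norms: $\|u\|_{C^{0,\alpha}}=|u(a)|+\sup_{s\ne t}|u(t)-u(s)|/|t-s|^\alpha$; $\|u\|_{W^{1,p}}=|u(a)|+\|u'\|_{L^p}$; $\|\cdot\|_\infty$ is the maximum norm. For $u\in C[a,b]$, $t\in[a,b]$: $\varphi_t(u)=\max_{s\in[a,t]}u(s)$, $M(u,t)=\{\tau\in[a,t]:u(\tau)=\varphi_t(u)\}$, and $\Phi(u,t)=\{\nu\in C[a,b]^*:\operatorname{supp}(\nu)\subset M(u,t),\ \nu\ge0,\ \|\nu\|=1\}$, where $C[a,b]^*$ is the space of signed regular Borel measures on $[a,b]$ with the weak-star topology. A measurable selector of $\Phi$ is a Borel measurable map $\mu:C[a,b]\times[a,b]\to C[a,b]^*$ with $\mu(u,t)\in\Phi(u,t)$ for all $(u,t)$. For $F:U\to B$ with $U\subset A$ open, $A,B$ normed, a set-valued map $G:U\rightrightarrows\mathcal{L}(A,B)$ (nonempty values, continuous linear maps) is a Newton derivative of $F$ in $U$ if $\lim_{h\to0}\sup_{L\in G(u+h)}\|F(u+h)-F(u)-Lh\|/\|h\|=0$ for every $u\in U$. *)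

theory Defs
  imports "HOL-Analysis.Analysis" "HOL-Probability.Essential_Supremum"
begin

section \<open>Normed spaces given by explicit carriers\<close>

text \<open>The function spaces below depend on real parameters, so they cannot be types.\<close>

record 'a normed_sp =
  nsp_carrier :: "'a set"
  nsp_add :: "'a \<Rightarrow> 'a \<Rightarrow> 'a"
  nsp_scale :: "real \<Rightarrow> 'a \<Rightarrow> 'a"
  nsp_norm :: "'a \<Rightarrow> real"

definition nsp_diff :: "'a normed_sp \<Rightarrow> 'a \<Rightarrow> 'a \<Rightarrow> 'a" where
  "nsp_diff A x y = nsp_add A x (nsp_scale A (- 1) y)"

definition nsp_open :: "'a normed_sp \<Rightarrow> 'a set \<Rightarrow> bool" where
  "nsp_open A U \<longleftrightarrow> U \<subseteq> nsp_carrier A \<and>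
     (\<forall>u\<in>U. \<exists>e>0. \<forall>v\<in>nsp_carrier A. nsp_norm A (nsp_diff A v u) < e \<longrightarrow> v \<in> U)"

text \<open>Continuous linear maps; continuity is expressed by boundedness. Maps are undefined off the
  carrier, so that equality of maps is equality on the carrier.\<close>

definition cont_linear_maps :: "'a normed_sp \<Rightarrow> 'b normed_sp \<Rightarrow> ('a \<Rightarrow> 'b) set" where
  "cont_linear_maps A B =
     {L \<in> nsp_carrier A \<rightarrow>\<^sub>E nsp_carrier B.
        (\<forall>x\<in>nsp_carrier A. \<forall>y\<in>nsp_carrier A. L (nsp_add A x y) = nsp_add B (L x) (L y)) \<and>
        (\<forall>c. \<forall>x\<in>nsp_carrier A. L (nsp_scale A c x) = nsp_scale B c (L x)) \<and>
        (\<exists>K. \<forall>x\<in>nsp_carrier A. nsp_norm B (L x) \<le> K * nsp_norm A x)}"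

definition newton_derivative ::
  "'a normed_sp \<Rightarrow> 'b normed_sp \<Rightarrow> 'a set \<Rightarrow> ('a \<Rightarrow> 'b) \<Rightarrow> ('a \<Rightarrow> ('a \<Rightarrow> 'b) set) \<Rightarrow> bool" where
  "newton_derivative A B U F G \<longleftrightarrow>
     nsp_open A U \<and> F ` U \<subseteq> nsp_carrier B \<and>
     (\<forall>u\<in>U. G u \<noteq> {} \<and> G u \<subseteq> cont_linear_maps A B) \<and>
     (\<forall>u\<in>U.
       ((\<lambda>h. SUP L\<in>G (nsp_add A u h).
              ennreal (nsp_norm B (nsp_diff B (nsp_diff B (F (nsp_add A u h)) (F u)) (L h))
                       / nsp_norm A h))
        \<longlongrightarrow> 0)
       (inf (filtercomap (nsp_norm A) (at_right 0))
            (principal {h \<in> nsp_carrier A. nsp_add A u h \<in> U})))"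

section \<open>The spaces of continuous, Hoelder and Sobolev functions\<close>

text \<open>Functions on \<open>[a,b]\<close> are represented by functions on \<open>\<real>\<close> that are undefined off \<open>[a,b]\<close>.\<close>

definition C_metric :: "real \<Rightarrow> real \<Rightarrow> (real \<Rightarrow> real) metric" where
  "C_metric a b = cfunspace (top_of_set {a..b}) euclidean_metric"

definition C_space :: "real \<Rightarrow> real \<Rightarrow> (real \<Rightarrow> real) set" where
  "C_space a b = mspace (C_metric a b)"

definition max_norm :: "real \<Rightarrow> real \<Rightarrow> (real \<Rightarrow> real) \<Rightarrow> real" where
  "max_norm a b u = (SUP t\<in>{a..b}. \<bar>u t\<bar>)"

definition hoelder_quotients :: "real \<Rightarrow> real \<Rightarrow> real \<Rightarrow> (real \<Rightarrow> real) \<Rightarrow> real set" where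
  "hoelder_quotients a b \<alpha> u =
     {\<bar>u t - u s\<bar> / \<bar>t - s\<bar> powr \<alpha> | s t. s \<in> {a..b} \<and> t \<in> {a..b} \<and> s \<noteq> t}"

definition hoelder_space :: "real \<Rightarrow> real \<Rightarrow> real \<Rightarrow> (real \<Rightarrow> real) normed_sp" where
  "hoelder_space a b \<alpha> =
     \<lparr>nsp_carrier = {u \<in> C_space a b. bdd_above (hoelder_quotients a b \<alpha> u)},
      nsp_add = (\<lambda>u v. \<lambda>t\<in>{a..b}. u t + v t),
      nsp_scale = (\<lambda>c u. \<lambda>t\<in>{a..b}. c * u t),
      nsp_norm = (\<lambda>u. \<bar>u a\<bar> + Sup (hoelder_quotients a b \<alpha> u))\<rparr>"

definition Lp_functions :: "real \<Rightarrow> real \<Rightarrow> ereal \<Rightarrow> (real \<Rightarrow> real) set" where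
  "Lp_functions a b p =
     {f \<in> borel_measurable (lebesgue_on {a<..<b}).
        if p = \<infinity> then esssup (lebesgue_on {a<..<b}) (\<lambda>t. ereal \<bar>f t\<bar>) < \<infinity>
        else integrable (lebesgue_on {a<..<b}) (\<lambda>t. \<bar>f t\<bar> powr real_of_ereal p)}"

definition Lp_seminorm :: "real \<Rightarrow> real \<Rightarrow> ereal \<Rightarrow> (real \<Rightarrow> real) \<Rightarrow> real" where
  "Lp_seminorm a b p f =
     (if p = \<infinity> then real_of_ereal (esssup (lebesgue_on {a<..<b}) (\<lambda>t. ereal \<bar>f t\<bar>))
      else (LINT t|lebesgue_on {a<..<b}. \<bar>f t\<bar> powr real_of_ereal p) powr (1 / real_of_ereal p))"

definition ae_eq :: "real \<Rightarrow> real \<Rightarrow> ((real \<Rightarrow> real) \<times> (real \<Rightarrow> real)) set" where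
  "ae_eq a b =
     {(f, g). f \<in> borel_measurable (lebesgue_on {a<..<b}) \<and>
              g \<in> borel_measurable (lebesgue_on {a<..<b}) \<and>
              (AE t in lebesgue_on {a<..<b}. f t = g t)}"

definition Lp_class :: "real \<Rightarrow> real \<Rightarrow> (real \<Rightarrow> real) \<Rightarrow> (real \<Rightarrow> real) set" where
  "Lp_class a b f = ae_eq a b `` {f}"

definition Lp_space :: "real \<Rightarrow> real \<Rightarrow> ereal \<Rightarrow> (real \<Rightarrow> real) set normed_sp" where
  "Lp_space a b p =
     \<lparr>nsp_carrier = Lp_functions a b p // ae_eq a b,
      nsp_add = (\<lambda>P Q. \<Union>f\<in>P. \<Union>g\<in>Q. Lp_class a b (\<lambda>t. f t + g t)),
      nsp_scale = (\<lambda>c P. \<Union>f\<in>P. Lp_class a b (\<lambda>t. c * f t)),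
      nsp_norm = (\<lambda>P. Lp_seminorm a b p (SOME f. f \<in> P))\<rparr>"

text \<open>Iterated derivatives differentiable everywhere on \<open>\<real>\<close> and compact support in \<open>(a,b)\<close>:
  the class \<open>C\<^sub>c\<^sup>\<infinity>(a,b)\<close>, extended by zero.\<close>

definition test_function :: "real \<Rightarrow> real \<Rightarrow> (real \<Rightarrow> real) \<Rightarrow> bool" where
  "test_function a b \<phi> \<longleftrightarrow>
     (\<forall>n x. (deriv ^^ n) \<phi> differentiable at x) \<and>
     (\<exists>c d. a < c \<and> d < b \<and> (\<forall>x. x \<notin> {c..d} \<longrightarrow> \<phi> x = 0))"

definition weak_derivative :: "real \<Rightarrow> real \<Rightarrow> (real \<Rightarrow> real) \<Rightarrow> (real \<Rightarrow> real) \<Rightarrow> bool" where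
  "weak_derivative a b u g \<longleftrightarrow>
     (\<forall>\<phi>. test_function a b \<phi> \<longrightarrow>
        (LINT t|lebesgue_on {a<..<b}. u t * deriv \<phi> t) = - (LINT t|lebesgue_on {a<..<b}. g t * \<phi> t))"

text \<open>The norm of \<open>W\<^sup>1\<^sup>,\<^sup>p(a,b)\<close> evaluates \<open>u\<close> at \<open>a\<close>: elements are identified with their continuous
  representatives on \<open>[a,b]\<close>. The weak derivative in \<open>L\<^sup>p\<close> is unique almost everywhere, so the choice
  made by \<open>SOME\<close> does not matter.\<close>

definition sobolev_space :: "real \<Rightarrow> real \<Rightarrow> ereal \<Rightarrow> (real \<Rightarrow> real) normed_sp" where
  "sobolev_space a b p =
     \<lparr>nsp_carrier = {u \<in> C_space a b. u \<in> Lp_functions a b p \<and>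
                       (\<exists>g\<in>Lp_functions a b p. weak_derivative a b u g)},
      nsp_add = (\<lambda>u v. \<lambda>t\<in>{a..b}. u t + v t),
      nsp_scale = (\<lambda>c u. \<lambda>t\<in>{a..b}. c * u t),
      nsp_norm = (\<lambda>u. \<bar>u a\<bar> +
        Lp_seminorm a b p (SOME g. g \<in> Lp_functions a b p \<and> weak_derivative a b u g))\<rparr>"

section \<open>Signed regular Borel measures with the weak-star topology\<close>

abbreviation borel_on :: "real \<Rightarrow> real \<Rightarrow> real measure" where
  "borel_on a b \<equiv> restrict_space borel {a..b}"

definition upper_variation :: "real \<Rightarrow> real \<Rightarrow> (real set \<Rightarrow> real) \<Rightarrow> real set \<Rightarrow> real" where
  "upper_variation a b \<nu> A = (SUP B\<in>{B \<in> sets (borel_on a b). B \<subseteq> A}. \<nu> B)"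

definition lower_variation :: "real \<Rightarrow> real \<Rightarrow> (real set \<Rightarrow> real) \<Rightarrow> real set \<Rightarrow> real" where
  "lower_variation a b \<nu> A = upper_variation a b (\<lambda>B. - \<nu> B) A"

definition total_variation :: "real \<Rightarrow> real \<Rightarrow> (real set \<Rightarrow> real) \<Rightarrow> real set \<Rightarrow> real" where
  "total_variation a b \<nu> A = upper_variation a b \<nu> A + lower_variation a b \<nu> A"

definition signed_measures :: "real \<Rightarrow> real \<Rightarrow> (real set \<Rightarrow> real) set" where
  "signed_measures a b =
     {\<nu> \<in> extensional (sets (borel_on a b)).
        \<nu> {} = 0 \<and>
        (\<forall>A :: nat \<Rightarrow> real set. range A \<subseteq> sets (borel_on a b) \<longrightarrow> disjoint_family A \<longrightarrow>
           (\<lambda>i. \<nu> (A i)) sums \<nu> (\<Union>i. A i)) \<and>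
        (\<forall>E\<in>sets (borel_on a b). \<forall>e>0. \<exists>K U. compact K \<and> K \<subseteq> E \<and> E \<subseteq> U \<and>
           openin (top_of_set {a..b}) U \<and> total_variation a b \<nu> (U - K) < e)}"

definition signed_measure_norm :: "real \<Rightarrow> real \<Rightarrow> (real set \<Rightarrow> real) \<Rightarrow> real" where
  "signed_measure_norm a b \<nu> = total_variation a b \<nu> {a..b}"

definition signed_measure_supp :: "real \<Rightarrow> real \<Rightarrow> (real set \<Rightarrow> real) \<Rightarrow> real set" where
  "signed_measure_supp a b \<nu> =
     {x \<in> {a..b}. \<forall>U. open U \<longrightarrow> x \<in> U \<longrightarrow> total_variation a b \<nu> (U \<inter> {a..b}) > 0}"

text \<open>Integration against a signed measure, through its Jordan decomposition.\<close>

definition pairing :: "real \<Rightarrow> real \<Rightarrow> (real set \<Rightarrow> real) \<Rightarrow> (real \<Rightarrow> real) \<Rightarrow> real" where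
  "pairing a b \<nu> h =
     (LINT s|measure_of {a..b} (sets (borel_on a b)) (\<lambda>A. ennreal (upper_variation a b \<nu> A)). h s) -
     (LINT s|measure_of {a..b} (sets (borel_on a b)) (\<lambda>A. ennreal (lower_variation a b \<nu> A)). h s)"

definition weak_star_topology :: "real \<Rightarrow> real \<Rightarrow> (real set \<Rightarrow> real) topology" where
  "weak_star_topology a b =
     pullback_topology (signed_measures a b) (\<lambda>\<nu>. \<lambda>h\<in>C_space a b. pairing a b \<nu> h)
       (product_topology (\<lambda>_. euclideanreal) (C_space a b))"

definition borel_of_topology :: "'a topology \<Rightarrow> 'a measure" where
  "borel_of_topology T = sigma (topspace T) {U. openin T U}"

section \<open>The cumulated maximum and the measurable selectors\<close>

definition running_max :: "real \<Rightarrow> (real \<Rightarrow> real) \<Rightarrow> real \<Rightarrow> real" where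
  "running_max a u t = (SUP s\<in>{a..t}. u s)"

definition maximizers :: "real \<Rightarrow> (real \<Rightarrow> real) \<Rightarrow> real \<Rightarrow> real set" where
  "maximizers a u t = {\<tau> \<in> {a..t}. u \<tau> = running_max a u t}"

definition max_subdiff :: "real \<Rightarrow> real \<Rightarrow> (real \<Rightarrow> real) \<Rightarrow> real \<Rightarrow> (real set \<Rightarrow> real) set" where
  "max_subdiff a b u t =
     {\<nu> \<in> signed_measures a b. signed_measure_supp a b \<nu> \<subseteq> maximizers a u t \<and>
        (\<forall>A\<in>sets (borel_on a b). \<nu> A \<ge> 0) \<and> signed_measure_norm a b \<nu> = 1}"

definition measurable_selectors ::
  "real \<Rightarrow> real \<Rightarrow> ((real \<Rightarrow> real) \<times> real \<Rightarrow> real set \<Rightarrow> real) set" where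
  "measurable_selectors a b =
     {\<mu> \<in> measurable
            (borel_of_topology
              (prod_topology (mtopology_of (C_metric a b)) (top_of_set {a..b})))
            (borel_of_topology (weak_star_topology a b)).
        \<forall>u\<in>C_space a b. \<forall>t\<in>{a..b}. \<mu> (u, t) \<in> max_subdiff a b u t}"

definition cumulated_max :: "real \<Rightarrow> real \<Rightarrow> (real \<Rightarrow> real) \<Rightarrow> (real \<Rightarrow> real) set" where
  "cumulated_max a b u = Lp_class a b (\<lambda>t. running_max a u t)"

definition cumulated_max_deriv ::
  "real \<Rightarrow> real \<Rightarrow> (real \<Rightarrow> real) normed_sp \<Rightarrow> (real \<Rightarrow> real) \<Rightarrow> ((real \<Rightarrow> real) \<Rightarrow> (real \<Rightarrow> real) set) set"
where
  "cumulated_max_deriv a b X u =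
     {(\<lambda>h\<in>nsp_carrier X. Lp_class a b (\<lambda>t. pairing a b (\<mu> (u, t)) h)) | \<mu>.
        \<mu> \<in> measurable_selectors a b}"

end

theory Submission
  imports Defs "HOL-Computational_Algebra.Polynomial" "HOL-Probability.Probability_Measure"
begin

text \<open>If \<open>\<tau>\<close> maximizes \<open>u + h\<close> and \<open>\<sigma>\<close> maximizes \<open>u\<close> over \<open>[a,t]\<close>, then \<open>0 \<le> \<phi>\<^sub>t(u) - u(\<tau>) \<le> h(\<tau>) - h(\<sigma>)\<close>.
  Integrating over a probability measure on the maximizers of \<open>u + h\<close> bounds the remainder at \<open>t\<close> by
  the Hoelder norm of \<open>h\<close> times \<open>dist(\<tau>, M(u,t))\<^sup>\<alpha>\<close>. The latter is at most \<open>(b - a)\<^sup>\<alpha>\<close>, and by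
  compactness it tends to zero for each fixed \<open>t\<close> as the maximum norm of \<open>h\<close> does, so dominated
  convergence gives the claim in \<open>L\<^sup>q\<close>. The Sobolev case reduces to the Hoelder case: testing the weak
  derivative against smoothed indicators of \<open>[s,t]\<close> yields the fundamental theorem of calculus, hence
  \<open>W\<^sup>1\<^sup>,\<^sup>p\<close> embeds into the Hoelder space of exponent \<open>1 - 1/p\<close> without increasing the norm. Selectors
  exist because the Dirac measure at the first maximizer is one: the first maximizer is lower
  semicontinuous in \<open>(u,t)\<close>, and Dirac measures depend weak-star continuously on their base point.\<close>

section \<open>Smooth step functions\<close>

text \<open>The selector is evaluated at \<open>u + h\<close>, not at \<open>u\<close>. On the
  maximizers of \<open>u + h\<close> the increment \<open>h\<close> equals the running maximum of
  \<open>u + h\<close> minus \<open>u\<close>, so \<open>h\<close> cancels from the remainder, which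
  becomes minus the mean of the nonnegative gap between the running maximum of \<open>u\<close> and
  \<open>u\<close> itself. \<open>h\<close> returns only when this gap is estimated. How small
  \<open>h\<close> must be for a given accuracy depends on the point t, through the shape of
  \<open>u\<close> near its maximizers, and the argument gives no rate uniform in t; this is where
  an integral norm with finite q enters. The threshold must nevertheless be uniform over all
  selectors and all \<open>h\<close>, so dominated convergence is applied along a sequence that
  would violate it. Weak derivatives are tested with infinitely differentiable functions only, so
  the smoothed indicators must be truly smooth. They are differences of shifted antiderivatives of
  exp(-1/y) with y = x(1-x), extended by zero. All derivatives of this bump have the form p(x)/y^k
  times the same exponential, which is the family defined here.\<close>

definition bump_fn :: "nat \<Rightarrow> real poly \<Rightarrow> real \<Rightarrow> real" where
  "bump_fn k p x = (if 0 < x \<and> x < 1 then poly p x / (x * (1 - x)) ^ k * exp (- 1 / (x * (1 - x))) else 0)"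

lemma DERIV_zero_if_quadratic_bound:
  fixes f :: "real \<Rightarrow> real"
  assumes "\<And>x. \<bar>f x\<bar> \<le> C * (x - z)\<^sup>2"
  shows "(f has_real_derivative 0) (at z)"
proof -
  have fz: "f z = 0" using assms[of z] by simp
  have "((\<lambda>x. (f x - f z) / (x - z)) \<longlongrightarrow> 0) (at z)"
  proof (rule Lim_null_comparison)
    show "\<forall>\<^sub>F x in at z. norm ((f x - f z) / (x - z)) \<le> C * \<bar>x - z\<bar>"
    proof (rule eventually_at_topological[THEN iffD2], intro exI conjI ballI impI)
      fix x assume "x \<noteq> z"
      then show "norm ((f x - f z) / (x - z)) \<le> C * \<bar>x - z\<bar>"
        using assms[of x] fz by (simp add: divide_simps power2_eq_square mult.assoc flip: abs_mult)
    qed (rule open_UNIV, simp)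
    show "((\<lambda>x. C * \<bar>x - z\<bar>) \<longlongrightarrow> 0) (at z)"
      by (rule tendsto_eq_intros refl | simp)+
  qed
  then show ?thesis by (simp add: has_field_derivative_iff)
qed

text \<open>A single term of the exponential series at \<open>1 / y\<close> bounds the sum from
  below; reciprocals then give decay faster than any power of \<open>y\<close>.\<close>

lemma exp_minus_inverse_le:
  fixes y :: real
  assumes "0 < y"
  shows "exp (- 1 / y) \<le> fact n * y ^ n"
proof -
  have "(1 / y) ^ n / fact n \<le> exp (1 / y)"
  proof -
    have "(\<lambda>m. (1/y) ^ m / fact m) sums exp (1/y)"
      using exp_converges[of "1/y"] by (simp add: field_simps)
    then show ?thesis
      using sum_le_suminf[of "\<lambda>m. (1/y) ^ m / fact m" "{n}"] assms
      by (auto simp: sums_iff)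
  qed
  then have "1 / exp (1 / y) \<le> 1 / ((1 / y) ^ n / fact n)"
    using assms by (intro divide_left_mono) auto
  then show ?thesis using assms by (simp add: exp_minus field_simps)
qed

text \<open>The exponential supplies \<open>k + 2\<close> powers of x(1-x): \<open>k\<close> of them
  cancel the denominator and two remain. Both factors are at most 1 inside the unit interval, so the
  remaining square is dominated by the squared distance to either endpoint, as the derivatives at 0
  and 1 require.\<close>

lemma bump_fn_quadratic_bound:
  obtains C where "\<And>x. \<bar>bump_fn k p x\<bar> \<le> C * x\<^sup>2" "\<And>x. \<bar>bump_fn k p x\<bar> \<le> C * (x - 1)\<^sup>2"
proof -
  have "bounded (poly p ` {0..1})"
    by (intro compact_imp_bounded compact_continuous_image continuous_intros) auto
  then obtain M where "M > 0" "\<forall>y\<in>poly p ` {0..1}. norm y \<le> M"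
    unfolding bounded_pos by blast
  then have M: "\<And>x. x \<in> {0..1} \<Longrightarrow> \<bar>poly p x\<bar> \<le> M" "M > 0" by auto
  let ?C = "M * fact (k + 2)"
  have C: "?C \<ge> 0" using M by simp
  have *: "\<bar>bump_fn k p x\<bar> \<le> ?C * (x * (1 - x))\<^sup>2" if "0 < x" "x < 1" for x
  proof -
    define y where "y = x * (1 - x)"
    have y: "y > 0" using that by (simp add: y_def)
    have "\<bar>bump_fn k p x\<bar> = \<bar>poly p x\<bar> / y ^ k * exp (- 1 / y)"
      using that y by (simp add: bump_fn_def y_def abs_mult)
    also have "\<dots> \<le> M / y ^ k * (fact (k + 2) * y ^ (k + 2))"
      using M(1)[of x] M(2) y that by (intro mult_mono exp_minus_inverse_le divide_right_mono) auto
    also have "\<dots> = ?C * y\<^sup>2" using y by (simp only: power_add) simp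
    finally show ?thesis by (simp add: y_def)
  qed
  show ?thesis
  proof
    fix x :: real
    show "\<bar>bump_fn k p x\<bar> \<le> ?C * x\<^sup>2"
    proof (cases "0 < x \<and> x < 1")
      case True
      have "(x * (1 - x))\<^sup>2 \<le> x\<^sup>2"
        using True by (intro power_mono) (auto simp: mult_le_cancel_left2)
      then show ?thesis using * True C by (meson mult_left_mono order_trans)
    qed (use C in \<open>auto simp: bump_fn_def\<close>)
    show "\<bar>bump_fn k p x\<bar> \<le> ?C * (x - 1)\<^sup>2"
    proof (cases "0 < x \<and> x < 1")
      case True
      have "(x * (1 - x))\<^sup>2 \<le> (1 - x)\<^sup>2"
        using True by (intro power_mono) (auto simp: mult_le_cancel_right2)
      then show ?thesis using * True C by (metis mult_left_mono order_trans power2_commute)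
    qed (use C in \<open>auto simp: bump_fn_def\<close>)
  qed
qed

lemma DERIV_poly_div_power_mult_exp:
  fixes w :: "real \<Rightarrow> real"
  assumes "(w has_real_derivative w') (at x)" "w x \<noteq> 0"
  shows "((\<lambda>x. poly p x / w x ^ k * exp (- 1 / w x)) has_real_derivative
        (poly (pderiv p) x * w x ^ k - poly p x * (of_nat k * w x ^ (k - 1) * w')) / (w x ^ k * w x ^ k) * exp (- 1 / w x)
          + poly p x / w x ^ k * (exp (- 1 / w x) * (w' / (w x * w x)))) (at x)"
  using assms by (auto intro!: derivative_eq_intros simp: field_simps)

text \<open>Closure of the family under differentiation. Here \<open>[:0, 1, -1:]\<close> is y =
  x(1-x) and \<open>[:1, -2:]\<close> is y'. The pole order grows by two because exp(-1/y)
  contributes y'/y^2. At the two endpoints the quadratic bound takes the place of the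
  formula.\<close>

lemma DERIV_bump_fn:
  "(bump_fn k p has_real_derivative
     bump_fn (k + 2) (pderiv p * [:0, 1, -1:]\<^sup>2 - of_nat k * p * [:1, -2:] * [:0, 1, -1:] + p * [:1, -2:]) x) (at x)"
    (is "(_ has_real_derivative bump_fn _ ?p x) _")
proof -
  consider "0 < x" "x < 1" | "x < 0 \<or> 1 < x" | "x = 0" | "x = 1" by linarith
  then show ?thesis
  proof cases
    case 1
    define y where "y = x * (1 - x)"
    have y: "y > 0" using 1 by (simp add: y_def)
    have "((\<lambda>x. poly p x / (x * (1 - x)) ^ k * exp (- 1 / (x * (1 - x)))) has_real_derivative
      bump_fn (k + 2) ?p x) (at x)"
    proof (rule DERIV_cong)
      show "((\<lambda>x. poly p x / (x * (1 - x)) ^ k * exp (- 1 / (x * (1 - x)))) has_real_derivative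
        (poly (pderiv p) x * y ^ k - poly p x * (of_nat k * y ^ (k - 1) * (1 - 2 * x))) / (y ^ k * y ^ k) * exp (- 1 / y)
          + poly p x / y ^ k * (exp (- 1 / y) * ((1 - 2 * x) / (y * y)))) (at x)"
        unfolding y_def using 1
        by (intro DERIV_poly_div_power_mult_exp derivative_eq_intros refl) auto
      \<comment> \<open>For \<open>k = 0\<close> the truncated \<open>k - 1\<close> is 0; the factor
        \<open>of_nat k\<close> then makes both sides vanish.\<close>
      have k: "of_nat k * y ^ (k - 1) = of_nat k * y ^ k / y"
        using y by (cases k) auto
      have "poly ?p x = poly (pderiv p) x * y\<^sup>2 - of_nat k * poly p x * (1 - 2 * x) * y + poly p x * (1 - 2 * x)"
        by (simp add: y_def algebra_simps power2_eq_square)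
      then have eq: "bump_fn (k + 2) ?p x = (poly (pderiv p) x * y\<^sup>2 - of_nat k * poly p x * (1 - 2 * x) * y + poly p x * (1 - 2 * x)) / y ^ (k + 2) * exp (- 1 / y)"
        using 1 by (simp add: bump_fn_def y_def)
      show "(poly (pderiv p) x * y ^ k - poly p x * (of_nat k * y ^ (k - 1) * (1 - 2 * x))) / (y ^ k * y ^ k) * exp (- 1 / y)
          + poly p x / y ^ k * (exp (- 1 / y) * ((1 - 2 * x) / (y * y))) = bump_fn (k + 2) ?p x"
        unfolding k eq using y by (simp add: field_simps power_add power2_eq_square)
    qed
    then show ?thesis
      by (rule has_field_derivative_transform_within_open[where S = "{0<..<1}"])
        (use 1 in \<open>auto simp: bump_fn_def\<close>)
  next
    case 2
    have "((\<lambda>x. 0) has_real_derivative bump_fn (k + 2) ?p x) (at x)"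
      using 2 by (auto simp: bump_fn_def)
    then show ?thesis
      by (rule has_field_derivative_transform_within_open[where S = "- {0..1}"])
        (use 2 in \<open>auto simp: bump_fn_def\<close>)
  next
    case 3
    obtain C where C: "\<And>x. \<bar>bump_fn k p x\<bar> \<le> C * x\<^sup>2" by (rule bump_fn_quadratic_bound[of k p]) blast
    then show ?thesis
      using DERIV_zero_if_quadratic_bound[of "bump_fn k p" C 0] 3 by (simp add: bump_fn_def)
  next
    case 4
    obtain C where C: "\<And>x. \<bar>bump_fn k p x\<bar> \<le> C * (x - 1)\<^sup>2" by (rule bump_fn_quadratic_bound[of k p]) blast
    then show ?thesis
      using DERIV_zero_if_quadratic_bound[of "bump_fn k p" C 1] 4 by (simp add: bump_fn_def)
  qed
qed

lemma continuous_on_bump_fn: "continuous_on S (bump_fn k p)"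
  by (meson DERIV_bump_fn DERIV_isCont continuous_at_imp_continuous_on)

text \<open>Iterating \<open>deriv\<close> never leaves a class closed under differentiation, so
  smoothness follows without a formula for the n-th derivative.\<close>

lemma smooth_coinduct:
  fixes f :: "real \<Rightarrow> real"
  assumes "S f" and step: "\<And>f. S f \<Longrightarrow> \<exists>g. S g \<and> (\<forall>x. (f has_real_derivative g x) (at x))"
  shows "(deriv ^^ n) f differentiable at x"
proof -
  have "S ((deriv ^^ n) f)"
  proof (induction n)
    case (Suc n)
    then obtain g where "S g" "\<And>x. ((deriv ^^ n) f has_real_derivative g x) (at x)"
      using step by blast
    moreover then have "deriv ((deriv ^^ n) f) = g" by (auto intro!: DERIV_imp_deriv)
    ultimately show ?case by simp
  qed (use assms in simp)
  then show ?thesis using step real_differentiable_def by blast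
qed

text \<open>The normalized antiderivative of the bump. Its derivative is stated as a
  \<open>bump_fn\<close>, so that smoothness can be drawn from the closure of that family.\<close>

lemma smooth_step_exists:
  obtains P :: "real \<Rightarrow> real" and c where "0 < c"
    "\<And>x. (P has_real_derivative bump_fn 0 [:c:] x) (at x)"
    "\<And>x. x \<le> 0 \<Longrightarrow> P x = 0" "\<And>x. 1 \<le> x \<Longrightarrow> P x = 1" "\<And>x. 0 \<le> P x" "\<And>x. P x \<le> 1"
proof -
  let ?B = "bump_fn 0 1"
  \<comment> \<open>Integrating from -1 rather than 0 makes 0 an interior point, so that the
    derivative there is two-sided.\<close>
  define Q where "Q x = integral {-1..x} ?B" for x
  have Q': "(Q has_real_derivative ?B x) (at x)" if "x > -1" for x
  proof -
    have "(Q has_real_derivative ?B x) (at x within {-1..x+1})"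
      unfolding Q_def using that
      by (intro integral_has_real_derivative continuous_on_bump_fn) auto
    then show ?thesis
      using at_within_Icc_at[of "-1" x "x + 1"] that by simp
  qed
  have B0: "?B x \<ge> 0" for x unfolding bump_fn_def by simp
  have mono: "Q x \<le> Q y" if "-1 < x" "x \<le> y" for x y
  proof (rule DERIV_nonneg_imp_nondecreasing[OF that(2)])
    fix z assume "x \<le> z"
    then show "\<exists>d. (Q has_real_derivative d) (at z) \<and> 0 \<le> d"
      using Q'[of z] B0[of z] that(1) by (intro exI[of _ "?B z"]) auto
  qed
  \<comment> \<open>A compact interval strictly inside the support, where the integrand is positive;
    monotonicity on both sides then gives positive total mass.\<close>
  have "Q (1/4) < Q (3/4)"
  proof (rule DERIV_pos_imp_increasing[of "1/4" "3/4" Q])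
    fix z :: real assume z: "1/4 \<le> z" "z \<le> 3/4"
    then have "0 < ?B z" unfolding bump_fn_def by simp
    then show "\<exists>d. (Q has_real_derivative d) (at z) \<and> 0 < d"
      using Q'[of z] z by (intro exI[of _ "?B z"]) auto
  qed simp
  moreover have "Q 0 \<le> Q (1/4)" "Q (3/4) \<le> Q 1" by (auto intro!: mono)
  ultimately have "Q 0 < Q 1" by linarith
  \<comment> \<open>The reciprocal of the total mass, so that the step rises from 0 to exactly
    1.\<close>
  define c where "c = 1 / (Q 1 - Q 0)"
  define P where "P x = (if x \<le> 0 then 0 else c * (Q x - Q 0))" for x
  have c: "c > 0" using \<open>Q 0 < Q 1\<close> by (simp add: c_def)
  have Q0: "Q x = Q 0" if "-1 < x" "x \<le> 0" for x
  proof (cases "x = 0")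
    case False
    have "(Q has_real_derivative 0) (at y within {x..0})" if "y \<in> {x..0}" for y
      using Q'[of y] that \<open>-1 < x\<close> by (auto intro!: has_field_derivative_at_within simp: bump_fn_def)
    then have "\<exists>k. \<forall>y\<in>{x..0}. Q y = k"
      by (intro has_field_derivative_zero_constant) auto
    then show ?thesis using that by (metis atLeastAtMost_iff order_refl)
  qed simp
  have Q1: "Q x = Q 1" if "1 \<le> x" for x
  proof -
    have "(Q has_real_derivative 0) (at y within {1..x})" if "y \<in> {1..x}" for y
      using Q'[of y] that by (auto intro!: has_field_derivative_at_within simp: bump_fn_def)
    then have "\<exists>k. \<forall>y\<in>{1..x}. Q y = k"
      by (intro has_field_derivative_zero_constant) auto
    then show ?thesis using that by (metis atLeastAtMost_iff order_refl)
  qed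
  have eqP: "P x = c * (Q x - Q 0)" if "x > -1" for x
    using Q0[of x] that by (auto simp: P_def)
  have P': "(P has_real_derivative bump_fn 0 [:c:] x) (at x)" for x
  proof (cases "x > -1")
    case True
    have "((\<lambda>x. c * (Q x - Q 0)) has_real_derivative bump_fn 0 [:c:] x) (at x)"
      using Q'[OF True] by (auto intro!: derivative_eq_intros simp: bump_fn_def)
    then show ?thesis
      by (rule has_field_derivative_transform_within_open[where S = "{-1<..}"])
        (use True eqP in auto)
  next
    case False
    have "((\<lambda>x. 0) has_real_derivative bump_fn 0 [:c:] x) (at x)"
      using False by (auto simp: bump_fn_def)
    then show ?thesis
      by (rule has_field_derivative_transform_within_open[where S = "{..<0}"])
        (use False in \<open>auto simp: P_def\<close>)
  qed
  have P1: "P x = 1" if "1 \<le> x" for x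
    using Q1[OF that] that \<open>Q 0 < Q 1\<close> by (simp add: P_def c_def)
  have P0: "0 \<le> P x" for x
    using mono[of 0 x] c by (auto simp: P_def)
  have "P x \<le> 1" for x
  proof (cases "0 \<le> x \<and> x \<le> 1")
    case True
    then have "c * (Q x - Q 0) \<le> c * (Q 1 - Q 0)"
      using mono[of x 1] c by (intro mult_left_mono) auto
    then show ?thesis using \<open>Q 0 < Q 1\<close> by (auto simp: P_def c_def)
  next
    case False
    then show ?thesis using P1[of x] by (auto simp: P_def)
  qed
  then show ?thesis using that[OF c P' _ P1 P0] by (auto simp: P_def)
qed

text \<open>A smoothed indicator of the interval from \<open>s\<close> to \<open>t\<close>. Left of
  \<open>s\<close> both steps are 0 and right of \<open>t + 1 / n\<close> both are 1, so they cancel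
  outside a compact subinterval.\<close>

lemma test_function_step_difference:
  fixes P :: "real \<Rightarrow> real"
  assumes P': "\<And>x. (P has_real_derivative bump_fn 0 [:c:] x) (at x)"
    and P0: "\<And>x. x \<le> 0 \<Longrightarrow> P x = 0" and P1: "\<And>x. 1 \<le> x \<Longrightarrow> P x = 1"
    and "a < s" "s < t" "0 < n" "t + 1 / n < b"
  shows "test_function a b (\<lambda>x. P (n * (x - s)) - P (n * (x - t)))"
proof -
  \<comment> \<open>The class for \<open>smooth_coinduct\<close>: \<open>P\<close> occurs only
    before the first differentiation, afterwards \<open>g\<close> is always a
    \<open>bump_fn\<close>; \<open>r\<close> collects the powers of \<open>n\<close> from the chain
    rule.\<close>
  define T where "T = (\<lambda>f. \<exists>r g. f = (\<lambda>x. r * (g (n * (x - s)) - g (n * (x - t)))) \<and>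
     (g = P \<or> (\<exists>k p. g = bump_fn k p)))"
  have step: "\<exists>f'. T f' \<and> (\<forall>x. (f has_real_derivative f' x) (at x))" if T: "T f" for f
  proof -
    obtain r g where f: "f = (\<lambda>x. r * (g (n * (x - s)) - g (n * (x - t))))"
      and g: "g = P \<or> (\<exists>k p. g = bump_fn k p)" using T unfolding T_def by blast
    obtain k p where kp: "\<And>x. (g has_real_derivative bump_fn k p x) (at x)"
      using g P' DERIV_bump_fn by metis
    have "\<forall>x. (f has_real_derivative (r * n) * (bump_fn k p (n * (x - s)) - bump_fn k p (n * (x - t)))) (at x)"
      unfolding f by (auto intro!: derivative_eq_intros DERIV_chain2[OF kp] simp: algebra_simps)
    then show ?thesis
      by (intro exI conjI) (auto simp: T_def intro!: exI[of _ "r * n"] exI[of _ "bump_fn k p"])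
  qed
  have "T (\<lambda>x. P (n * (x - s)) - P (n * (x - t)))"
    unfolding T_def by (intro exI[of _ 1] exI[of _ P]) simp
  note smooth = smooth_coinduct[of T, OF this step]
  have "P (n * (x - s)) - P (n * (x - t)) = 0" if "x \<notin> {s..t + 1 / n}" for x
  proof (cases "x < s")
    case True
    then have "n * (x - s) \<le> 0" "n * (x - t) \<le> 0"
      using assms by (auto simp: mult_le_0_iff)
    then show ?thesis using P0 by simp
  next
    case False
    then have "x > t + 1 / n" using that by auto
    then have "n * (x - t) \<ge> 1" using assms by (simp add: field_simps)
    moreover then have "n * (x - s) \<ge> 1" using assms by (smt (verit) mult_left_mono)
    ultimately show ?thesis using P1 by simp
  qed
  then show ?thesis unfolding test_function_def using smooth assms by blast
qed

section \<open>Increments of weakly differentiable functions\<close>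

lemma finite_measure_Ioo: "finite_measure (lebesgue_on {a<..<b::real})"
  by (intro finite_measure_lebesgue_on bounded_set_imp_lmeasurable) auto

lemma integrable_Ioo_if_bounded:
  fixes f :: "real \<Rightarrow> real"
  assumes "f \<in> borel_measurable (lebesgue_on {a<..<b})" "\<And>x. x \<in> {a<..<b} \<Longrightarrow> \<bar>f x\<bar> \<le> K"
  shows "integrable (lebesgue_on {a<..<b}) f"
  using assms
  by (intro finite_measure.integrable_const_bound[OF finite_measure_Ioo, of _ K]) (auto intro!: AE_I2)

lemma measurable_Ioo_if_continuous:
  fixes f :: "real \<Rightarrow> real"
  assumes "continuous_on {a..b} f"
  shows "f \<in> borel_measurable (lebesgue_on {a<..<b})"
  by (rule continuous_imp_measurable_on_sets_lebesgue[OF continuous_on_subset[OF assms]]) auto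

lemma bounded_Icc_if_continuous:
  fixes f :: "real \<Rightarrow> real"
  assumes "continuous_on {a..b} f"
  obtains K where "0 < K" "\<And>x. x \<in> {a..b} \<Longrightarrow> \<bar>f x\<bar> \<le> K"
proof -
  have "bounded (f ` {a..b})"
    by (intro compact_imp_bounded compact_continuous_image assms) auto
  then show ?thesis using that unfolding bounded_pos by auto
qed

lemma integrable_Ioo_mult_continuous:
  fixes f g :: "real \<Rightarrow> real"
  assumes "integrable (lebesgue_on {a<..<b}) g" "continuous_on {a..b} f"
  shows "integrable (lebesgue_on {a<..<b}) (\<lambda>x. g x * f x)"
proof -
  obtain K where K: "0 < K" "\<And>x. x \<in> {a..b} \<Longrightarrow> \<bar>f x\<bar> \<le> K"
    using bounded_Icc_if_continuous[OF assms(2)] by blast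
  show ?thesis
  proof (rule Bochner_Integration.integrable_bound)
    show "integrable (lebesgue_on {a<..<b}) (\<lambda>x. K * g x)" using assms(1) by simp
    show "(\<lambda>x. g x * f x) \<in> borel_measurable (lebesgue_on {a<..<b})"
      using assms(1) measurable_Ioo_if_continuous[OF assms(2)] by (intro borel_measurable_times) auto
    show "AE x in lebesgue_on {a<..<b}. norm (g x * f x) \<le> norm (K * g x)"
      using K by (intro AE_I2) (auto simp: abs_mult mult.commute intro!: mult_right_mono)
  qed
qed

lemma integrable_Ioo_if_continuous:
  fixes f :: "real \<Rightarrow> real"
  assumes "continuous_on {a..b} f"
  shows "integrable (lebesgue_on {a<..<b}) f"
proof -
  have "integrable (lebesgue_on {a<..<b}) (\<lambda>_. 1 :: real)"
    by (rule finite_measure.integrable_const[OF finite_measure_Ioo])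
  from integrable_Ioo_mult_continuous[OF this assms] show ?thesis by simp
qed

lemma integral_Ioo_FTC:
  fixes f :: "real \<Rightarrow> real"
  assumes "a \<le> b" "\<And>x. x \<in> {a..b} \<Longrightarrow> (F has_real_derivative f x) (at x)" "continuous_on {a..b} f"
  shows "(LINT x|lebesgue_on {a<..<b}. f x) = F b - F a"
proof -
  have "(f has_integral F b - F a) {a..b}"
    using assms by (intro fundamental_theorem_of_calculus)
      (auto simp: has_real_derivative_iff_has_vector_derivative[symmetric] intro: has_field_derivative_at_within)
  then have "integral {a<..<b} f = F b - F a"
    by (simp flip: integral_open_interval_real add: integral_unique)
  then show ?thesis
    using lebesgue_integral_eq_integral[OF integrable_Ioo_if_continuous[OF assms(3)]] by simp
qed

section \<open>One-sided mollifiers and the fundamental theorem for weak derivatives\<close>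

lemma DERIV_affine_comp:
  fixes P :: "real \<Rightarrow> real"
  assumes "\<And>x. (P has_real_derivative f x) (at x)"
  shows "((\<lambda>x. P (r * (x - s))) has_real_derivative r * f (r * (x - s))) (at x)"
proof -
  have "((\<lambda>x. r * (x - s)) has_real_derivative r) (at x)"
    by (auto intro!: derivative_eq_intros)
  from DERIV_chain2[OF assms this] show ?thesis by (simp add: mult.commute)
qed

text \<open>The weights have mass 1 and live between \<open>s\<close> and \<open>s + 1 / n\<close>,
  so they form a one-sided approximate identity that averages the values of \<open>u\<close> just to
  the right of \<open>s\<close>.\<close>

lemma bump_fn_mollifier:
  fixes u :: "real \<Rightarrow> real"
  assumes P: "0 < c" "\<And>x. (P has_real_derivative bump_fn 0 [:c:] x) (at x)"
    "\<And>x. x \<le> 0 \<Longrightarrow> P x = 0" "\<And>x. 1 \<le> x \<Longrightarrow> P x = (1::real)"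
    and s: "a < s" "s < b" and u: "continuous_on {a..b} u"
  shows "(\<lambda>n. LINT x|lebesgue_on {a<..<b}. u x * (real n * bump_fn 0 [:c:] (real n * (x - s)))) \<longlonglongrightarrow> u s"
proof -
  define w where "w n x = real n * bump_fn 0 [:c:] (real n * (x - s))" for n x
  have w_cont: "continuous_on {a..b} (w n)" for n
    unfolding w_def by (intro continuous_intros continuous_on_compose2[OF continuous_on_bump_fn[of UNIV]]) auto
  have w_nonneg: "0 \<le> w n x" for n x
    using P(1) by (simp add: w_def bump_fn_def)
  \<comment> \<open>The window must end before \<open>b\<close>, so that the rescaled step has
    already reached 1 there.\<close>
  have w_int: "(LINT x|lebesgue_on {a<..<b}. w n x) = 1" if n: "n > 0" "s + 1 / real n < b" for n
  proof -
    have "(LINT x|lebesgue_on {a<..<b}. w n x) = P (real n * (b - s)) - P (real n * (a - s))"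
      using s DERIV_affine_comp[of P, OF P(2)]
      by (intro integral_Ioo_FTC[where F = "\<lambda>x. P (real n * (x - s))"] w_cont) (simp_all add: w_def)
    moreover have "P (real n * (b - s)) = 1" using n by (intro P(4)) (simp add: field_simps)
    moreover have "P (real n * (a - s)) = 0" using s by (intro P(3)) (simp add: mult_nonneg_nonpos)
    ultimately show ?thesis by simp
  qed
  have "(\<lambda>n. LINT x|lebesgue_on {a<..<b}. u x * w n x) \<longlonglongrightarrow> u s"
  proof (rule LIMSEQ_I)
    fix r :: real assume "r > 0"
    define e where "e = r / 2"
    have e: "e > 0" using \<open>r > 0\<close> by (simp add: e_def)
    obtain d where d: "d > 0" "\<And>x. x \<in> {a..b} \<Longrightarrow> dist x s < d \<Longrightarrow> dist (u x) (u s) < e"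
      using u s e unfolding continuous_on_iff by (metis atLeastAtMost_iff less_imp_le)
    obtain N where N: "inverse (real (Suc N)) < min d (b - s)"
      using reals_Archimedean[of "min d (b - s)"] d s by auto
    have "norm ((LINT x|lebesgue_on {a<..<b}. u x * w n x) - u s) < r" if "n \<ge> Suc N" for n
    proof -
      have "inverse (real n) \<le> inverse (real (Suc N))"
        using that by (intro le_imp_inverse_le) auto
      then have n: "1 / real n < d" "s + 1 / real n < b"
        using N unfolding divide_inverse min_less_iff_conj by linarith+
      have "n > 0" using that by simp
      note n = this n
      have int: "integrable (lebesgue_on {a<..<b}) (\<lambda>x. (u x - u s) * w n x)"
        by (intro integrable_Ioo_if_continuous continuous_intros u w_cont)
      \<comment> \<open>Mass 1 allows \<open>u s\<close> to be written as an average of a constant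
        with the same weights.\<close>
      have "(LINT x|lebesgue_on {a<..<b}. u x * w n x) - u s = (LINT x|lebesgue_on {a<..<b}. u x * w n x) - u s * (LINT x|lebesgue_on {a<..<b}. w n x)"
        using w_int n by simp
      also have "\<dots> = (LINT x|lebesgue_on {a<..<b}. u x * w n x - u s * w n x)"
        by (subst Bochner_Integration.integral_diff) (auto intro!: integrable_Ioo_if_continuous continuous_intros u w_cont)
      also have "\<dots> = (LINT x|lebesgue_on {a<..<b}. (u x - u s) * w n x)"
        by (simp add: algebra_simps)
      also have "norm \<dots> \<le> (LINT x|lebesgue_on {a<..<b}. e * w n x)"
      proof (rule Bochner_Integration.integral_norm_bound_integral[OF int])
        show "integrable (lebesgue_on {a<..<b}) (\<lambda>x. e * w n x)"
          by (intro integrable_Ioo_if_continuous continuous_intros w_cont)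
        fix x assume "x \<in> space (lebesgue_on {a<..<b})"
        then have x: "x \<in> {a<..<b}" by simp
        show "norm ((u x - u s) * w n x) \<le> e * w n x"
        proof (cases "0 < real n * (x - s) \<and> real n * (x - s) < 1")
          case True
          then have "x - s < 1 / real n" "s < x" using n(1) by (auto simp: field_simps zero_less_mult_iff)
          then have "dist x s < d" using n by (simp add: dist_real_def)
          then have "\<bar>u x - u s\<bar> \<le> e" using d(2)[of x] x by (auto simp: dist_real_def)
          then show ?thesis using w_nonneg[of n x] by (simp add: abs_mult mult_right_mono)
        next
          case False
          then have "w n x = 0" unfolding w_def bump_fn_def by auto
          then show ?thesis by simp
        qed
      qed
      also have "\<dots> = e" using w_int n by simp
      finally show ?thesis using \<open>r > 0\<close> by (simp add: e_def)
    qed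
    then show "\<exists>no. \<forall>n\<ge>no. norm ((LINT x|lebesgue_on {a<..<b}. u x * w n x) - u s) < r" by blast
  qed
  then show ?thesis by (simp add: w_def)
qed

text \<open>For \<open>x > s\<close> the argument eventually exceeds 1, while at
  \<open>x = s\<close> it stays at 0, where \<open>P\<close> vanishes. This is why the limiting
  intervals are open on the left.\<close>

lemma step_tendsto_indicator:
  fixes P :: "real \<Rightarrow> real"
  assumes P: "\<And>x. x \<le> 0 \<Longrightarrow> P x = 0" "\<And>x. 1 \<le> x \<Longrightarrow> P x = 1"
  shows "(\<lambda>n. P (real n * (x - s))) \<longlonglongrightarrow> indicator {s<..} x"
proof (cases "x \<le> s")
  case True
  then show ?thesis by (simp add: P mult_nonneg_nonpos)
next
  case False
  obtain N where "1 / (x - s) < real N" using reals_Archimedean2 by blast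
  then have "P (real n * (x - s)) = 1" if "n \<ge> N" for n
    using that False P(2) by (smt (verit) divide_less_eq of_nat_le_iff mult_right_mono)
  then show ?thesis using False
    by (intro tendsto_eventually) (auto simp: eventually_sequentially)
qed

text \<open>The derivative of a smoothed indicator is a difference of two mollifiers, so the left
  side of the weak formulation tends to \<open>u s - u t\<close>. The smoothed indicators are
  bounded by 1, so \<open>\<bar>g x\<bar>\<close> dominates the integrands on the right.\<close>

lemma weak_derivative_increment:
  fixes u g :: "real \<Rightarrow> real"
  assumes u: "continuous_on {a..b} u" and g: "integrable (lebesgue_on {a<..<b}) g"
    and w: "weak_derivative a b u g" and st: "a < s" "s < t" "t < b"
  shows "u t - u s = (LINT x|lebesgue_on {a<..<b}. g x * indicator {s<..t} x)"
proof -
  obtain P :: "real \<Rightarrow> real" and c where P: "0 < c"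
    "\<And>x. (P has_real_derivative bump_fn 0 [:c:] x) (at x)"
    "\<And>x. x \<le> 0 \<Longrightarrow> P x = 0" "\<And>x. 1 \<le> x \<Longrightarrow> P x = 1" "\<And>x. 0 \<le> P x" "\<And>x. P x \<le> 1"
    by (rule smooth_step_exists) blast
  let ?M = "lebesgue_on {a<..<b}"
  let ?w = "\<lambda>n s x. real n * bump_fn 0 [:c:] (real n * (x - s))"
  define \<phi> where "\<phi> n x = P (real n * (x - s)) - P (real n * (x - t))" for n x
  have deriv_\<phi>: "deriv (\<phi> n) x = ?w n s x - ?w n t x" for n x
    unfolding \<phi>_def
    by (intro DERIV_imp_deriv DERIV_diff DERIV_affine_comp P(2))
  have cont: "continuous_on {a..b} (?w n r)" for n r
    by (intro continuous_intros continuous_on_compose2[OF continuous_on_bump_fn[of UNIV]]) auto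
  have P_cont: "continuous_on UNIV P"
    using P(2) by (meson DERIV_isCont continuous_at_imp_continuous_on)
  have lim_u: "(\<lambda>n. LINT x|?M. u x * deriv (\<phi> n) x) \<longlonglongrightarrow> u s - u t"
  proof -
    have "(LINT x|?M. u x * deriv (\<phi> n) x) = (LINT x|?M. u x * ?w n s x) - (LINT x|?M. u x * ?w n t x)" for n
      unfolding deriv_\<phi> right_diff_distrib[of "u _"]
      by (subst Bochner_Integration.integral_diff) (auto intro!: integrable_Ioo_if_continuous continuous_intros u cont)
    then show ?thesis
      using tendsto_diff[OF bump_fn_mollifier[OF P(1-4) _ _ u] bump_fn_mollifier[OF P(1-4) _ _ u], of s t] st
      by simp
  qed
  have lim_g: "(\<lambda>n. - (LINT x|?M. g x * \<phi> n x)) \<longlonglongrightarrow> - (LINT x|?M. g x * indicator {s<..t} x)"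
  proof (intro tendsto_minus integral_dominated_convergence[where w = "\<lambda>x. \<bar>g x\<bar>"])
    show "(\<lambda>x. g x * \<phi> n x) \<in> borel_measurable ?M" for n
      unfolding \<phi>_def using g
      by (intro borel_measurable_times borel_measurable_integrable measurable_Ioo_if_continuous
          continuous_intros continuous_on_compose2[OF P_cont]) auto
    show "(\<lambda>x. g x * indicator {s<..t} x) \<in> borel_measurable ?M"
      using g st by (intro borel_measurable_times borel_measurable_integrable borel_measurable_indicator)
        (auto simp: sets_restrict_space_iff)
    show "integrable ?M (\<lambda>x. \<bar>g x\<bar>)" using g by simp
    show "AE x in ?M. norm (g x * \<phi> n x) \<le> \<bar>g x\<bar>" for n
    proof (rule AE_I2)
      fix x
      have "\<bar>\<phi> n x\<bar> \<le> 1"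
        using P(5,6)[of "real n * (x - s)"] P(5,6)[of "real n * (x - t)"] by (simp add: \<phi>_def)
      then show "norm (g x * \<phi> n x) \<le> \<bar>g x\<bar>"
        by (simp add: abs_mult mult_left_le)
    qed
    show "AE x in ?M. (\<lambda>n. g x * \<phi> n x) \<longlonglongrightarrow> g x * indicator {s<..t} x"
    proof (rule AE_I2, intro tendsto_intros)
      fix x
      have "(\<lambda>n. \<phi> n x) \<longlonglongrightarrow> indicator {s<..} x - indicator {t<..} x"
        unfolding \<phi>_def by (intro tendsto_diff step_tendsto_indicator P(3,4))
      also have "indicator {s<..} x - indicator {t<..} x = (indicator {s<..t} x :: real)"
        using st by (auto simp: indicator_def)
      finally show "(\<lambda>n. \<phi> n x) \<longlonglongrightarrow> indicator {s<..t} x" .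
    qed
  qed
  \<comment> \<open>The support reaches up to \<open>t + 1 / n\<close>, so \<open>\<phi> n\<close>
    is a test function on the interval only for large \<open>n\<close>.\<close>
  have "\<forall>\<^sub>F n in sequentially. (LINT x|?M. u x * deriv (\<phi> n) x) = - (LINT x|?M. g x * \<phi> n x)"
  proof -
    obtain N where N: "inverse (real (Suc N)) < b - t"
      using reals_Archimedean[of "b - t"] st by auto
    have "test_function a b (\<phi> n)" if "n \<ge> Suc N" for n
    proof -
      have "inverse (real n) \<le> inverse (real (Suc N))" using that by (intro le_imp_inverse_le) auto
      then have "t + 1 / real n < b" using N by (simp add: divide_inverse)
      then show ?thesis unfolding \<phi>_def using that st
        by (intro test_function_step_difference[of P c] P) auto
    qed
    then show ?thesis using w unfolding weak_derivative_def eventually_sequentially by blast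
  qed
  from LIMSEQ_unique[OF Lim_transform_eventually[OF lim_u this] lim_g]
  show ?thesis by simp
qed

section \<open>Hoelder's inequality on subintervals and the Morrey estimate\<close>

lemma measure_Ioc_Ioo_le:
  assumes "s \<le> (t::real)"
  shows "(LINT x|lebesgue_on {a<..<b}. indicator {s<..t} x) \<le> t - s"
proof -
  have "(LINT x|lebesgue_on {a<..<b}. indicator {s<..t} x) = measure (lebesgue_on {a<..<b}) ({s<..t} \<inter> {a<..<b})"
    by simp
  also have "\<dots> = measure lebesgue ({s<..t} \<inter> {a<..<b})"
    by (intro measure_restrict_space) auto
  also have "\<dots> \<le> measure lebesgue {s..t}"
    by (intro measure_mono_fmeasurable) auto
  finally show ?thesis using assms by simp
qed

text \<open>\<open>real_of_ereal\<close> sends infinite values to 0, so the essential supremum must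
  first be shown finite: from above by membership, from below because the interval has positive
  measure.\<close>

lemma AE_le_Lp_seminorm_infinity:
  assumes "a < b" "f \<in> Lp_functions a b \<infinity>"
  shows "AE t in lebesgue_on {a<..<b}. \<bar>f t\<bar> \<le> Lp_seminorm a b \<infinity> f" "0 \<le> Lp_seminorm a b \<infinity> f"
proof -
  let ?M = "lebesgue_on {a<..<b}"
  define e where "e = esssup ?M (\<lambda>t. ereal \<bar>f t\<bar>)"
  have ae: "AE t in ?M. ereal \<bar>f t\<bar> \<le> e" unfolding e_def by (rule esssup_AE)
  have "e \<ge> 0"
  proof (rule ccontr)
    assume "\<not> 0 \<le> e"
    then have "\<not> ereal \<bar>f t\<bar> \<le> e" for t
      using order_trans[of 0 "ereal \<bar>f t\<bar>" e] by auto
    then have "AE t in ?M. False" using ae by simp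
    then have "emeasure ?M (space ?M) = 0" by (simp add: eventually_False ae_filter_eq_bot_iff)
    moreover have "emeasure ?M (space ?M) = ennreal (b - a)"
      using \<open>a < b\<close> by (simp add: emeasure_restrict_space)
    ultimately show False using \<open>a < b\<close> by simp
  qed
  moreover have "e < \<infinity>" using assms(2) by (simp add: Lp_functions_def e_def)
  ultimately obtain N where N: "e = ereal N" by (cases e) auto
  have "Lp_seminorm a b \<infinity> f = N" using N by (simp add: Lp_seminorm_def flip: e_def)
  then show "AE t in ?M. \<bar>f t\<bar> \<le> Lp_seminorm a b \<infinity> f" "0 \<le> Lp_seminorm a b \<infinity> f"
    using ae N \<open>e \<ge> 0\<close> by simp_all
qed

lemma Lp_functions_measurable: "f \<in> Lp_functions a b p \<Longrightarrow> f \<in> borel_measurable (lebesgue_on {a<..<b})"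
  by (simp add: Lp_functions_def)

lemma Lp_functions_integrable:
  assumes "a < b" "1 < p" "f \<in> Lp_functions a b p"
  shows "integrable (lebesgue_on {a<..<b}) f"
proof (cases "p = \<infinity>")
  case True
  show ?thesis
    using AE_le_Lp_seminorm_infinity(1)[of a b f] assms Lp_functions_measurable True
    by (intro finite_measure.integrable_const_bound[OF finite_measure_Ioo, of _ "Lp_seminorm a b \<infinity> f"]) auto
next
  case False
  then obtain r where r: "p = ereal r" "1 < r" using assms(2) by (cases p) auto
  show ?thesis
  proof (rule Bochner_Integration.integrable_bound)
    show "integrable (lebesgue_on {a<..<b}) (\<lambda>x. 1 + \<bar>f x\<bar> powr r)"
      using assms(3) r by (intro Bochner_Integration.integrable_add finite_measure.integrable_const[OF finite_measure_Ioo])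
        (simp add: Lp_functions_def)
    show "f \<in> borel_measurable (lebesgue_on {a<..<b})" using assms(3) by (rule Lp_functions_measurable)
    \<comment> \<open>The embedding into the integrable functions on a finite measure space: the
      constant 1 covers small values and the power covers large ones.\<close>
    have "\<bar>f x\<bar> \<le> 1 + \<bar>f x\<bar> powr r" for x
      using powr_mono[of 1 r "\<bar>f x\<bar>"] r by (cases "\<bar>f x\<bar> \<le> 1") (auto intro: add_increasing2)
    then show "AE x in lebesgue_on {a<..<b}. norm (f x) \<le> norm (1 + \<bar>f x\<bar> powr r)"
      by (intro AE_I2) (smt (verit) real_norm_def)
  qed
qed

text \<open>The exponent of the one-dimensional Morrey embedding.\<close>

definition sobolev_exponent :: "ereal \<Rightarrow> real" where
  "sobolev_exponent p = (if p = \<infinity> then 1 else 1 - 1 / real_of_ereal p)"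

lemma sobolev_exponent_pos: "1 < p \<Longrightarrow> 0 < sobolev_exponent p"
  by (cases p) (auto simp: sobolev_exponent_def)

lemma Lp_seminorm_nonneg:
  assumes "a < b" "1 < p" "f \<in> Lp_functions a b p"
  shows "0 \<le> Lp_seminorm a b p f"
  using AE_le_Lp_seminorm_infinity(2)[of a b f] assms by (cases "p = \<infinity>") (auto simp: Lp_seminorm_def)

text \<open>Hoelder's inequality against the indicator of an interval, obtained by integrating
  Young's inequality for the two normalized factors.\<close>

lemma integral_Ioc_le_Lp_seminorm:
  assumes "a < b" "1 < p" and f: "f \<in> Lp_functions a b p" and st: "a \<le> s" "s < t" "t < b"
  shows "(LINT x|lebesgue_on {a<..<b}. \<bar>f x\<bar> * indicator {s<..t} x)
           \<le> Lp_seminorm a b p f * (t - s) powr sobolev_exponent p"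
proof -
  let ?M = "lebesgue_on {a<..<b}"
  have f_int: "integrable ?M (\<lambda>x. \<bar>f x\<bar> * indicator {s<..t} x)"
    using Lp_functions_integrable[OF assms(1-3)] st
    by (intro integrable_real_mult_indicator) (auto simp: sets_restrict_space_iff)
  have ind_int: "integrable ?M (indicator {s<..t} :: real \<Rightarrow> real)"
    using st by (intro integrable_Ioo_if_bounded[of _ _ _ 1] borel_measurable_indicator)
      (auto simp: sets_restrict_space_iff indicator_def)
  show ?thesis
  proof (cases "p = \<infinity>")
    case True
    have "(LINT x|?M. \<bar>f x\<bar> * indicator {s<..t} x) \<le> (LINT x|?M. Lp_seminorm a b p f * indicator {s<..t} x)"
      using AE_le_Lp_seminorm_infinity(1)[of a b f] assms True
      by (intro integral_mono_AE f_int integrable_mult_right ind_int) (auto intro: mult_right_mono elim: eventually_mono)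
    also have "\<dots> = Lp_seminorm a b p f * (LINT x|?M. indicator {s<..t} x)"
      by (rule integral_mult_right_zero)
    also have "\<dots> \<le> Lp_seminorm a b p f * (t - s)"
      using measure_Ioc_Ioo_le[of s t a b] st Lp_seminorm_nonneg[OF assms(1-3)] by (intro mult_left_mono) auto
    finally show ?thesis using True st by (simp add: sobolev_exponent_def)
  next
    case False
    then obtain r where r: "p = ereal r" "1 < r" using assms(2) by (cases p) auto
    define I where "I = (LINT x|?M. \<bar>f x\<bar> powr r)"
    have int: "integrable ?M (\<lambda>x. \<bar>f x\<bar> powr r)" using f r by (simp add: Lp_functions_def)
    have "I \<ge> 0" unfolding I_def by simp
    show ?thesis
    \<comment> \<open>The normalization divides by the seminorm, so the functions that vanish almost
      everywhere are treated apart.\<close>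
    proof (cases "I = 0")
      case True
      then have "AE x in ?M. \<bar>f x\<bar> powr r = 0"
        using int unfolding I_def by (subst (asm) integral_nonneg_eq_0_iff_AE) auto
      then have "(LINT x|?M. \<bar>f x\<bar> * indicator {s<..t} x) = (LINT x|?M. 0)"
        using f_int by (intro integral_cong_AE) (auto elim: eventually_mono)
      then show ?thesis using Lp_seminorm_nonneg[OF assms(1-3)] by simp
    next
      case False
      then have I: "I > 0" using \<open>I \<ge> 0\<close> by simp
      define r' where "r' = r / (r - 1)"
      have r': "r' > 1" "1 / r + 1 / r' = 1" using r by (auto simp: r'_def field_simps)
      define d where "d = t - s"
      have d: "d > 0" using st by (simp add: d_def)
      \<comment> \<open>The two normalizing factors: \<open>A\<close> is the seminorm of
        \<open>f\<close>, and \<open>B\<close> is the norm with the conjugate exponent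
        \<open>r'\<close> of an interval of length \<open>d\<close>.\<close>
      define A where "A = I powr (1 / r)"
      define B where "B = d powr (1 / r')"
      have AB: "A > 0" "B > 0" "A powr r = I" "B powr r' = d"
        using I d r r' by (auto simp: A_def B_def powr_powr)
      have young: "\<bar>f x\<bar> * indicator {s<..t} x \<le> A * B * (\<bar>f x\<bar> powr r / (r * I) + indicator {s<..t} x / (r' * d))" for x
      proof -
        have "\<bar>f x\<bar> / A * (indicator {s<..t} x / B) \<le> (\<bar>f x\<bar> / A) powr r / r + (indicator {s<..t} x / B) powr r' / r'"
          using AB r r' by (intro Youngs_inequality) auto
        also have "\<dots> = \<bar>f x\<bar> powr r / (r * I) + indicator {s<..t} x / (r' * d)"
          using AB r r' by (auto simp: powr_divide indicator_def mult.commute)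
        finally show ?thesis using AB by (simp add: field_simps)
      qed
      have "(LINT x|?M. \<bar>f x\<bar> * indicator {s<..t} x)
          \<le> (LINT x|?M. A * B * (\<bar>f x\<bar> powr r / (r * I) + indicator {s<..t} x / (r' * d)))"
        using f_int int ind_int young by (intro integral_mono integrable_mult_right Bochner_Integration.integrable_add integrable_divide_zero) auto
      also have "\<dots> = A * B * (I / (r * I) + (LINT x|?M. indicator {s<..t} x) / (r' * d))"
      proof -
        have "(LINT x|?M. \<bar>f x\<bar> powr r / (r * I) + indicator {s<..t} x / (r' * d))
            = I / (r * I) + (LINT x|?M. indicator {s<..t} x) / (r' * d)"
          unfolding I_def using int ind_int
          by (subst Bochner_Integration.integral_add) (auto intro: integrable_divide_zero)
        then show ?thesis by (simp only: integral_mult_right_zero)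
      qed
      \<comment> \<open>The interval has measure at most \<open>d\<close>, so the bracket is at most
        1/r + 1/r' = 1.\<close>
      also have "\<dots> \<le> A * B * (1 / r + d / (r' * d))"
        using measure_Ioc_Ioo_le[of s t a b] st AB I d r r'
        by (intro mult_left_mono add_mono divide_right_mono) (auto simp: d_def)
      also have "\<dots> = A * B" using r' d by simp
      also have "\<dots> = Lp_seminorm a b p f * (t - s) powr sobolev_exponent p"
        using r r' by (simp add: Lp_seminorm_def A_def B_def d_def I_def sobolev_exponent_def)
          (metis add_diff_cancel_left')
      finally show ?thesis .
    qed
  qed
qed

text \<open>Test functions give the increment between interior points only. The estimate passes to
  the closed square because the difference \<open>D\<close> of its two sides is continuous there,
  the exponent being positive.\<close>

lemma sobolev_increment:
  assumes "a < b" "1 < p" and u: "continuous_on {a..b} u"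
    and g: "g \<in> Lp_functions a b p" and w: "weak_derivative a b u g"
    and st: "s \<in> {a..b}" "t \<in> {a..b}"
  shows "\<bar>u t - u s\<bar> \<le> Lp_seminorm a b p g * \<bar>t - s\<bar> powr sobolev_exponent p"
proof -
  let ?\<alpha> = "sobolev_exponent p" and ?N = "Lp_seminorm a b p g"
  note \<alpha> = sobolev_exponent_pos[OF assms(2)]
  note gi = Lp_functions_integrable[OF assms(1,2) g]
  have less: "\<bar>u t - u s\<bar> \<le> ?N * \<bar>t - s\<bar> powr ?\<alpha>" if "a < s" "s < t" "t < b" for s t
  proof -
    have "\<bar>u t - u s\<bar> = \<bar>LINT x|lebesgue_on {a<..<b}. g x * indicator {s<..t} x\<bar>"
      using weak_derivative_increment[OF u gi w that] by simp
    also have "\<dots> \<le> (LINT x|lebesgue_on {a<..<b}. \<bar>g x * indicator {s<..t} x\<bar>)"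
      by (rule integral_abs_bound)
    also have "\<dots> = (LINT x|lebesgue_on {a<..<b}. \<bar>g x\<bar> * indicator {s<..t} x)"
      by (simp add: abs_mult)
    also have "\<dots> \<le> ?N * (t - s) powr ?\<alpha>"
      using that by (intro integral_Ioc_le_Lp_seminorm[OF assms(1,2) g]) auto
    finally show ?thesis using that by simp
  qed
  have inner: "\<bar>u t - u s\<bar> \<le> ?N * \<bar>t - s\<bar> powr ?\<alpha>" if "s \<in> {a<..<b}" "t \<in> {a<..<b}" for s t
    using less[of s t] less[of t s] that by (cases s t rule: linorder_cases) (auto simp: abs_minus_commute)
  define D where "D = (\<lambda>z. ?N * \<bar>snd z - fst z\<bar> powr ?\<alpha> - \<bar>u (snd z) - u (fst z)\<bar>)"
  have cl: "closure ({a<..<b} \<times> {a<..<b}) = {a..b} \<times> {a..b}"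
    using assms(1) by (simp add: closure_Times)
  have "continuous_on ({a..b} \<times> {a..b}) D"
    unfolding D_def using \<alpha>
    by (intro continuous_intros continuous_on_powr' continuous_on_compose2[OF u]) auto
  then have "0 \<le> D (s, t)"
    using inner st cl by (intro continuous_ge_on_closure[of "{a<..<b} \<times> {a<..<b}" D "(s, t)" 0]) (auto simp: D_def)
  then show ?thesis by (simp add: D_def)
qed

section \<open>Running maxima and their maximizers\<close>

text \<open>Compactness of the interval makes the boundedness built into \<open>cfunspace\<close>
  automatic.\<close>

lemma C_space_iff: "u \<in> C_space a b \<longleftrightarrow> continuous_on {a..b} u \<and> u \<in> extensional {a..b}"
proof -
  have "compactin (top_of_set {a..b}) (topspace (top_of_set {a..b}))"
    by (simp add: compactin_subtopology)
  then show ?thesis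
    unfolding C_space_def C_metric_def by (subst compactin_mspace_cfunspace) auto
qed

lemma C_space_bounded:
  assumes "u \<in> C_space a b"
  obtains K where "0 < K" "\<And>x. x \<in> {a..b} \<Longrightarrow> \<bar>u x\<bar> \<le> K"
  using assms bounded_Icc_if_continuous[of a b u] by (auto simp: C_space_iff)

lemma max_norm_bounds:
  assumes "u \<in> C_space a b" "x \<in> {a..b}"
  shows "\<bar>u x\<bar> \<le> max_norm a b u"
proof -
  obtain K where "\<And>x. x \<in> {a..b} \<Longrightarrow> \<bar>u x\<bar> \<le> K" using C_space_bounded[OF assms(1)] by blast
  then show ?thesis unfolding max_norm_def
    by (intro cSUP_upper[OF assms(2)] bdd_aboveI2[of _ _ K]) auto
qed

lemma max_norm_le:
  assumes "a \<le> b" "\<And>x. x \<in> {a..b} \<Longrightarrow> \<bar>u x\<bar> \<le> K"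
  shows "max_norm a b u \<le> K"
  unfolding max_norm_def using assms by (intro cSUP_least) auto

lemma running_max_attained:
  assumes "u \<in> C_space a b" "t \<in> {a..b}"
  obtains \<tau> where "\<tau> \<in> {a..t}" "u \<tau> = running_max a u t"
    "\<And>s. s \<in> {a..t} \<Longrightarrow> u s \<le> running_max a u t"
proof -
  have "continuous_on {a..t} u"
    using assms by (auto simp: C_space_iff intro: continuous_on_subset)
  then obtain \<tau> where \<tau>: "\<tau> \<in> {a..t}" "\<And>s. s \<in> {a..t} \<Longrightarrow> u s \<le> u \<tau>"
    using continuous_attains_sup[of "{a..t}" u] assms(2) by auto
  have "running_max a u t = u \<tau>"
    unfolding running_max_def using \<tau> by (intro cSup_eq_maximum) auto
  then show ?thesis using that \<tau> by simp
qed

lemma running_max_upper: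
  assumes "u \<in> C_space a b" "t \<in> {a..b}" "s \<in> {a..t}"
  shows "u s \<le> running_max a u t"
  by (rule running_max_attained[OF assms(1,2)]) (use assms(3) in blast)

lemma running_max_le_iff:
  assumes "u \<in> C_space a b" "t \<in> {a..b}"
  shows "running_max a u t \<le> y \<longleftrightarrow> (\<forall>s\<in>{a..t}. u s \<le> y)"
proof -
  obtain \<tau> where "\<tau> \<in> {a..t}" "u \<tau> = running_max a u t"
    "\<And>s. s \<in> {a..t} \<Longrightarrow> u s \<le> running_max a u t"
    using running_max_attained[OF assms] by blast
  then show ?thesis by fastforce
qed

lemma running_max_mono:
  assumes "u \<in> C_space a b" "t \<in> {a..b}" "s \<in> {a..t}"
  shows "running_max a u s \<le> running_max a u t"
proof -
  have "s \<in> {a..b}" using assms(2,3) by auto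
  then show ?thesis
    using running_max_upper[OF assms(1,2)] assms(3) by (subst running_max_le_iff[OF assms(1)]) auto
qed

lemma running_max_diff_le:
  assumes "u \<in> C_space a b" "v \<in> C_space a b" "t \<in> {a..b}" "\<And>x. x \<in> {a..b} \<Longrightarrow> \<bar>u x - v x\<bar> \<le> e"
  shows "\<bar>running_max a u t - running_max a v t\<bar> \<le> e"
proof -
  have *: "running_max a u t \<le> running_max a v t + e"
    if "u \<in> C_space a b" "v \<in> C_space a b" "\<And>x. x \<in> {a..b} \<Longrightarrow> \<bar>u x - v x\<bar> \<le> e" for u v
  proof (subst running_max_le_iff[OF that(1) assms(3)], intro ballI)
    fix s assume s: "s \<in> {a..t}"
    then show "u s \<le> running_max a v t + e"
      using running_max_upper[OF that(2) assms(3) s] that(3)[of s] assms(3) by auto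
  qed
  show ?thesis using *[of u v] *[of v u] assms by (auto simp: abs_minus_commute abs_le_iff)
qed

text \<open>Passing from the smaller to the larger endpoint adds only points closer than
  \<open>d\<close> to the smaller one, and their values exceed the value there by at most
  \<open>e\<close>. The running maximum thus inherits the modulus of continuity of
  \<open>u\<close>.\<close>

lemma running_max_modulus:
  assumes u: "u \<in> C_space a b" and st: "s \<in> {a..b}" "t \<in> {a..b}" and d: "\<bar>s - t\<bar> < d"
    and mod: "\<And>x y. x \<in> {a..b} \<Longrightarrow> y \<in> {a..b} \<Longrightarrow> \<bar>x - y\<bar> < d \<Longrightarrow> \<bar>u x - u y\<bar> \<le> e" and "0 \<le> e"
  shows "\<bar>running_max a u s - running_max a u t\<bar> \<le> e"
proof -
  have *: "\<bar>running_max a u s - running_max a u t\<bar> \<le> e"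
    if st: "s \<le> t" "s \<in> {a..b}" "t \<in> {a..b}" "\<bar>s - t\<bar> < d" for s t
  proof -
    obtain \<tau> where \<tau>: "\<tau> \<in> {a..t}" "u \<tau> = running_max a u t" using running_max_attained[OF u st(3)] by blast
    have "running_max a u t \<le> running_max a u s + e"
    proof (cases "\<tau> \<le> s")
      case True
      then show ?thesis using running_max_upper[OF u st(2), of \<tau>] \<tau> \<open>0 \<le> e\<close> by auto
    next
      case False
      then have "\<bar>u s - u \<tau>\<bar> \<le> e" using \<tau> st by (intro mod) auto
      then show ?thesis using running_max_upper[OF u st(2), of s] \<tau> st by auto
    qed
    moreover have "running_max a u s \<le> running_max a u t"
      using st by (intro running_max_mono[OF u]) auto
    ultimately show ?thesis by auto
  qed
  show ?thesis using *[of s t] *[of t s] st d by (cases "s \<le> t") (auto simp: abs_minus_commute)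
qed

lemma C_space_modulus:
  assumes "u \<in> C_space a b" "0 < e"
  obtains d where "0 < d" "\<And>x y. x \<in> {a..b} \<Longrightarrow> y \<in> {a..b} \<Longrightarrow> \<bar>x - y\<bar> < d \<Longrightarrow> \<bar>u x - u y\<bar> \<le> e"
proof -
  have "uniformly_continuous_on {a..b} u"
    using assms by (intro compact_uniformly_continuous) (auto simp: C_space_iff)
  then obtain d where "d > 0" "\<And>x y. x \<in> {a..b} \<Longrightarrow> y \<in> {a..b} \<Longrightarrow> dist y x < d \<Longrightarrow> dist (u y) (u x) < e"
    unfolding uniformly_continuous_on_def using assms(2) by meson
  then show ?thesis using that[of d] by (force simp: dist_real_def less_imp_le)
qed

lemma continuous_on_running_max:
  assumes u: "u \<in> C_space a b"
  shows "continuous_on {a..b} (running_max a u)"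
  unfolding continuous_on_iff
proof (intro ballI allI impI)
  fix t e :: real assume t: "t \<in> {a..b}" and "e > 0"
  then have "e / 2 > 0" by simp
  obtain d where d: "0 < d" "\<And>x y. x \<in> {a..b} \<Longrightarrow> y \<in> {a..b} \<Longrightarrow> \<bar>x - y\<bar> < d \<Longrightarrow> \<bar>u x - u y\<bar> \<le> e / 2"
    using C_space_modulus[OF u \<open>e / 2 > 0\<close>] by blast
  then have "dist (running_max a u s) (running_max a u t) < e" if "s \<in> {a..b}" "dist s t < d" for s
    using running_max_modulus[OF u that(1) t, of d "e / 2"] that d \<open>e > 0\<close> by (auto simp: dist_real_def)
  then show "\<exists>d>0. \<forall>s\<in>{a..b}. dist s t < d \<longrightarrow> dist (running_max a u s) (running_max a u t) < e"
    using d(1) by blast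
qed

section \<open>Joint continuity in function and time, and Borel sets of a topology\<close>

abbreviation CI_topology :: "real \<Rightarrow> real \<Rightarrow> ((real \<Rightarrow> real) \<times> real) topology" where
  "CI_topology a b \<equiv> prod_topology (mtopology_of (C_metric a b)) (top_of_set {a..b})"

lemma topspace_CI: "topspace (CI_topology a b) = C_space a b \<times> {a..b}"
  by (simp add: C_space_def)

text \<open>The cutoff \<open>c\<close> prepares the study of the first maximizer: comparing the
  maximum up to \<open>c\<close> with the full one decides whether a maximizer occurs up to
  \<open>c\<close>.\<close>

lemma continuous_map_running_max_min:
  assumes "a \<le> c"
  shows "continuous_map (CI_topology a b) euclideanreal (\<lambda>(u, t). running_max a u (min c t))"
proof -
  let ?f = "\<lambda>(u, t). running_max a u (min c t)"
  have "\<exists>U. openin (CI_topology a b) U \<and> x \<in> U \<and> (\<forall>y\<in>U. ?f y \<in> ball (?f x) e)"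
    if x: "x \<in> topspace (CI_topology a b)" and e: "e > 0" for x e
  proof -
    obtain u0 t0 where x_eq: "x = (u0, t0)" and u0: "u0 \<in> C_space a b" and t0: "t0 \<in> {a..b}"
      using x unfolding topspace_CI by auto
    \<comment> \<open>One third pays for the change of \<open>u\<close>, one for the change of
      \<open>t\<close>, and the last one for the strict inequality.\<close>
    have "e / 3 > 0" using e by simp
    obtain d where d: "0 < d" "\<And>x y. x \<in> {a..b} \<Longrightarrow> y \<in> {a..b} \<Longrightarrow> \<bar>x - y\<bar> < d \<Longrightarrow> \<bar>u0 x - u0 y\<bar> \<le> e / 3"
      using C_space_modulus[OF u0 \<open>e / 3 > 0\<close>] by blast
    define U where "U = mball_of (C_metric a b) u0 (e / 3) \<times> ({a..b} \<inter> ball t0 d)"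
    have "openin (mtopology_of (C_metric a b)) (mball_of (C_metric a b) u0 (e / 3))"
      by (simp add: mball_of_def mtopology_of_def Metric_space.openin_mball)
    moreover have "openin (top_of_set {a..b}) ({a..b} \<inter> ball t0 d)"
      by (simp add: openin_open_Int)
    ultimately have "openin (CI_topology a b) U"
      unfolding U_def openin_prod_Times_iff by blast
    moreover have "x \<in> U"
      using u0 t0 d(1) e by (simp add: x_eq U_def C_space_def Metric_space.mdist_zero[OF Metric_space_mspace_mdist])
    moreover have "?f y \<in> ball (?f x) e" if yU: "y \<in> U" for y
    proof -
      obtain u t where y: "y = (u, t)" and u: "u \<in> C_space a b" "mdist (C_metric a b) u0 u < e / 3"
        and t: "t \<in> {a..b}" "\<bar>t0 - t\<bar> < d"
        using yU by (auto simp: U_def C_space_def dist_real_def)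
      have "\<bar>u0 x - u x\<bar> \<le> e / 3" if "x \<in> {a..b}" for x
        using cfunspace_mdist_le[of u0 "top_of_set {a..b}" euclidean_metric u "e / 3"] u0 u that
        by (auto simp: C_metric_def C_space_def dist_real_def)
      then have "\<bar>running_max a u0 (min c t) - running_max a u (min c t)\<bar> \<le> e / 3"
        using t assms by (intro running_max_diff_le[OF u0 u(1)]) auto
      \<comment> \<open>Truncation by \<open>min c\<close> does not increase distances, so the
        modulus of \<open>u0\<close> still applies.\<close>
      moreover have "\<bar>running_max a u0 (min c t0) - running_max a u0 (min c t)\<bar> \<le> e / 3"
        using t t0 assms e by (intro running_max_modulus[OF u0 _ _ _ d(2)]) (auto simp: min_def)
      ultimately have "dist (running_max a u0 (min c t0)) (running_max a u (min c t)) < e"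
        using e unfolding dist_real_def by linarith
      then show ?thesis by (simp add: x_eq y)
    qed
    ultimately show ?thesis by blast
  qed
  then show ?thesis
    using Met_TC.continuous_map_to_metric[of "CI_topology a b" ?f] by simp
qed

lemma space_borel_of_topology [simp]: "space (borel_of_topology T) = topspace T"
  unfolding borel_of_topology_def by (rule space_measure_of) (auto dest: openin_subset)

lemma sets_borel_of_topology: "sets (borel_of_topology T) = sigma_sets (topspace T) {U. openin T U}"
  unfolding borel_of_topology_def by (rule sets_measure_of) (auto dest: openin_subset)

lemma openin_borel_of_topology: "openin T U \<Longrightarrow> U \<in> sets (borel_of_topology T)"
  by (auto simp: sets_borel_of_topology)

lemma closedin_borel_of_topology:
  assumes "closedin T C"
  shows "C \<in> sets (borel_of_topology T)"
proof -
  have "topspace T - (topspace T - C) \<in> sets (borel_of_topology T)"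
    using assms sets.compl_sets[OF openin_borel_of_topology, of T "topspace T - C"] by (simp add: closedin_def)
  then show ?thesis using closedin_subset[OF assms] by (simp add: double_diff)
qed

lemma measurable_borel_of_topology:
  assumes "f \<in> space M \<rightarrow> topspace T" "\<And>U. openin T U \<Longrightarrow> f -` U \<inter> space M \<in> sets M"
  shows "f \<in> measurable M (borel_of_topology T)"
  unfolding borel_of_topology_def
  by (rule measurable_measure_of) (use assms in \<open>auto dest: openin_subset\<close>)

lemma borel_measurable_if_continuous_map:
  assumes "continuous_map T euclideanreal f"
  shows "f \<in> borel_measurable (borel_of_topology T)"
proof (rule borel_measurableI)
  fix S :: "real set" assume "open S"
  then have "openin T {x \<in> topspace T. f x \<in> S}"
    using openin_continuous_map_preimage[OF assms, of S] \<open>open S\<close> by simp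
  moreover have "f -` S \<inter> space (borel_of_topology T) = {x \<in> topspace T. f x \<in> S}" by auto
  ultimately show "f -` S \<inter> space (borel_of_topology T) \<in> sets (borel_of_topology T)"
    by (simp add: openin_borel_of_topology)
qed

section \<open>The first maximizer and its measurability\<close>

definition first_maximizer :: "real \<Rightarrow> (real \<Rightarrow> real) \<Rightarrow> real \<Rightarrow> real" where
  "first_maximizer a u t = Inf (maximizers a u t)"

lemma compact_maximizers:
  assumes "u \<in> C_space a b" "t \<in> {a..b}"
  shows "compact (maximizers a u t)"
proof -
  have "continuous_on {a..t} u"
    using assms by (auto simp: C_space_iff intro: continuous_on_subset)
  then have "closed ({a..t} \<inter> u -` {running_max a u t})"
    by (intro continuous_closed_preimage) auto
  moreover have "{a..t} \<inter> u -` {running_max a u t} = maximizers a u t"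
    by (auto simp: maximizers_def)
  ultimately have "closed (maximizers a u t)" by simp
  moreover have "bounded (maximizers a u t)"
    by (rule bounded_subset[of "{a..t}"]) (auto simp: maximizers_def)
  ultimately show ?thesis by (simp add: compact_eq_bounded_closed)
qed

lemma maximizers_nonempty:
  assumes "u \<in> C_space a b" "t \<in> {a..b}"
  shows "maximizers a u t \<noteq> {}"
  using running_max_attained[OF assms] unfolding maximizers_def by blast

lemma first_maximizer:
  assumes "u \<in> C_space a b" "t \<in> {a..b}"
  shows "first_maximizer a u t \<in> maximizers a u t"
    "\<tau> \<in> maximizers a u t \<Longrightarrow> first_maximizer a u t \<le> \<tau>"
proof -
  have cl: "closed (maximizers a u t)" "bdd_below (maximizers a u t)"
    using compact_maximizers[OF assms] by (auto intro: compact_imp_closed bounded_imp_bdd_below compact_imp_bounded)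
  then show "first_maximizer a u t \<in> maximizers a u t"
    unfolding first_maximizer_def by (intro closed_contains_Inf maximizers_nonempty[OF assms])
  show "first_maximizer a u t \<le> \<tau>" if "\<tau> \<in> maximizers a u t"
    unfolding first_maximizer_def using cl that by (intro cInf_lower)
qed

text \<open>Turns a sublevel set of the first maximizer into the set where two continuous functions
  of \<open>(u, t)\<close> agree, hence into a closed set.\<close>

lemma first_maximizer_le_iff:
  assumes u: "u \<in> C_space a b" and t: "t \<in> {a..b}" and "a \<le> c"
  shows "first_maximizer a u t \<le> c \<longleftrightarrow> running_max a u (min c t) = running_max a u t"
proof
  have mt: "min c t \<in> {a..b}" using assms by auto
  note f = first_maximizer[OF u t]
  assume "first_maximizer a u t \<le> c"
  then have "u (first_maximizer a u t) \<le> running_max a u (min c t)"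
    using f(1) by (intro running_max_upper[OF u mt]) (auto simp: maximizers_def)
  moreover have "running_max a u (min c t) \<le> running_max a u t"
    using assms by (intro running_max_mono[OF u]) auto
  ultimately show "running_max a u (min c t) = running_max a u t"
    using f(1) by (auto simp: maximizers_def)
next
  have mt: "min c t \<in> {a..b}" using assms by auto
  assume "running_max a u (min c t) = running_max a u t"
  then obtain \<tau> where "\<tau> \<in> {a..min c t}" "u \<tau> = running_max a u t"
    using running_max_attained[OF u mt] by metis
  then show "first_maximizer a u t \<le> c"
    using first_maximizer(2)[OF u t, of \<tau>] by (auto simp: maximizers_def)
qed

lemma borel_measurable_first_maximizer:
  "(\<lambda>(u, t). first_maximizer a u t) \<in> borel_measurable (borel_of_topology (CI_topology a b))"
  unfolding borel_measurable_iff_le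
proof
  fix c
  let ?T = "CI_topology a b"
  show "{w \<in> space (borel_of_topology ?T). (case w of (u, t) \<Rightarrow> first_maximizer a u t) \<le> c} \<in> sets (borel_of_topology ?T)"
  proof (cases "a \<le> c")
    \<comment> \<open>Maximizers never lie to the left of \<open>a\<close>, so such a sublevel set
      is empty.\<close>
    case False
    have eq: "{w \<in> space (borel_of_topology ?T). (case w of (u, t) \<Rightarrow> first_maximizer a u t) \<le> c} = {}"
      unfolding space_borel_of_topology topspace_CI
      using False first_maximizer(1)[of _ a b] by (force simp: maximizers_def)
    show ?thesis unfolding eq by simp
  next
    case True
    \<comment> \<open>The cutoff \<open>max a b\<close> is inactive for \<open>t\<close> in the
      interval; it lets the full running maximum be covered by the same continuity lemma.\<close>
    define D where "D = (\<lambda>w. (case w of (u, t) \<Rightarrow> running_max a u (min c t)) - (case w of (u, t) \<Rightarrow> running_max a u (min (max a b) t)))"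
    have "continuous_map ?T euclideanreal D"
      unfolding D_def by (intro continuous_map_diff continuous_map_running_max_min True) simp
    then have "closedin ?T {w \<in> topspace ?T. D w \<in> {0}}"
      by (intro closedin_continuous_map_preimage) auto
    moreover have eq: "{w \<in> topspace ?T. D w \<in> {0}} = {w \<in> space (borel_of_topology ?T). (case w of (u, t) \<Rightarrow> first_maximizer a u t) \<le> c}"
      unfolding space_borel_of_topology topspace_CI
      using first_maximizer_le_iff[OF _ _ True, of _ b] by (auto simp: D_def min_absorb2)
    ultimately show ?thesis using closedin_borel_of_topology[of ?T] unfolding eq by blast
  qed
qed

section \<open>Measures on the set of maximizers\<close>

definition as_measure :: "real \<Rightarrow> real \<Rightarrow> (real set \<Rightarrow> real) \<Rightarrow> real measure" where
  "as_measure a b \<nu> = measure_of {a..b} (sets (borel_on a b)) (\<lambda>A. ennreal (\<nu> A))"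

lemma space_as_measure [simp]: "space (as_measure a b \<nu>) = {a..b}"
  unfolding as_measure_def
  using sets.space_closed[of "borel_on a b"] by (subst space_measure_of) auto

lemma sets_as_measure [simp]: "sets (as_measure a b \<nu>) = sets (borel_on a b)"
  unfolding as_measure_def
  using sets.space_closed[of "borel_on a b"] sets.sigma_sets_eq[of "borel_on a b"]
  by (subst sets_measure_of) auto

text \<open>Regularity is left out, so that a Dirac measure can be an instance before its regularity
  is known; the variations occurring in the regularity condition are then plain values of the
  measure.\<close>

locale nonneg_measure =
  fixes a b :: real and \<nu> :: "real set \<Rightarrow> real"
  assumes empty: "\<nu> {} = 0"
    and sums: "\<And>A :: nat \<Rightarrow> real set. range A \<subseteq> sets (borel_on a b) \<Longrightarrow> disjoint_family A \<Longrightarrow>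
           (\<lambda>i. \<nu> (A i)) sums \<nu> (\<Union>i. A i)"
    and nonneg: "\<And>A. A \<in> sets (borel_on a b) \<Longrightarrow> 0 \<le> \<nu> A"
begin

abbreviation "N \<equiv> as_measure a b \<nu>"

lemma emeasure_N: "A \<in> sets (borel_on a b) \<Longrightarrow> emeasure N A = ennreal (\<nu> A)"
proof (rule emeasure_measure_of[OF as_measure_def])
  show "sets (borel_on a b) \<subseteq> Pow {a..b}"
    using sets.space_closed[of "borel_on a b"] by simp
  show "positive (sets N) (\<lambda>A. ennreal (\<nu> A))"
    by (simp add: positive_def empty)
  show "countably_additive (sets N) (\<lambda>A. ennreal (\<nu> A))"
  proof (rule countably_additiveI)
    fix A :: "nat \<Rightarrow> real set"
    assume A: "range A \<subseteq> sets N" "disjoint_family A" "(\<Union>i. A i) \<in> sets N"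
    then have "(\<lambda>i. \<nu> (A i)) sums \<nu> (\<Union>i. A i)" by (intro sums) auto
    then have "(\<lambda>i. ennreal (\<nu> (A i))) sums ennreal (\<nu> (\<Union>i. A i))"
      using A nonneg by (subst sums_ennreal) auto
    then show "(\<Sum>i. ennreal (\<nu> (A i))) = ennreal (\<nu> (\<Union>i. A i))" by (simp add: sums_iff)
  qed
qed simp

lemma mono: "A \<in> sets (borel_on a b) \<Longrightarrow> B \<in> sets (borel_on a b) \<Longrightarrow> B \<subseteq> A \<Longrightarrow> \<nu> B \<le> \<nu> A"
  using emeasure_mono[of B A N] by (simp add: emeasure_N nonneg)

lemma upper_variation_eq: "A \<in> sets (borel_on a b) \<Longrightarrow> upper_variation a b \<nu> A = \<nu> A"
  unfolding upper_variation_def using mono by (intro cSup_eq_maximum) auto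

lemma lower_variation_eq: "A \<in> sets (borel_on a b) \<Longrightarrow> lower_variation a b \<nu> A = 0"
  unfolding lower_variation_def upper_variation_def
  using nonneg empty by (intro cSup_eq_maximum) (auto intro!: image_eqI[where x = "{}"])

lemma total_variation_eq: "A \<in> sets (borel_on a b) \<Longrightarrow> total_variation a b \<nu> A = \<nu> A"
  by (simp add: total_variation_def upper_variation_eq lower_variation_eq)

text \<open>The Jordan decomposition of a nonnegative measure is trivial: the upper variation is the
  measure itself and the lower one is null, so the second integral in \<open>pairing\<close>
  vanishes.\<close>

lemma pairing_eq: "pairing a b \<nu> h = (LINT s|N. h s)"
proof -
  have cl: "sets (borel_on a b) \<subseteq> Pow {a..b}" "sigma_sets {a..b} (sets (borel_on a b)) = sets (borel_on a b)"
    using sets.space_closed[of "borel_on a b"] sets.sigma_sets_eq[of "borel_on a b"] by auto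
  have "measure_of {a..b} (sets (borel_on a b)) (\<lambda>A. ennreal (upper_variation a b \<nu> A)) = N"
    unfolding as_measure_def using cl by (intro measure_of_eq) (auto simp: upper_variation_eq)
  moreover have "measure_of {a..b} (sets (borel_on a b)) (\<lambda>A. ennreal (lower_variation a b \<nu> A))
      = sigma {a..b} (sets (borel_on a b))"
    using cl by (intro measure_of_eq) (auto simp: lower_variation_eq)
  moreover have "(LINT s|sigma {a..b} (sets (borel_on a b)). h s) = 0"
    by (intro integral_eq_zero_AE AE_I[of _ _ "{a..b}"]) (use cl sets.top[of "borel_on a b"] in \<open>auto simp: emeasure_sigma space_measure_of\<close>)
  ultimately show ?thesis by (simp add: pairing_def)
qed

text \<open>The complement of the support is covered by open null sets. There may be uncountably
  many of them; by the Lindelof property countably many suffice, and their union is null.\<close>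

lemma AE_support:
  assumes "signed_measure_supp a b \<nu> \<subseteq> S"
  shows "AE s in N. s \<in> S"
proof -
  define F where "F = {U. open U \<and> emeasure N (U \<inter> {a..b}) = 0}"
  have "\<And>U. U \<in> F \<Longrightarrow> open U" by (simp add: F_def)
  then obtain F' where F': "F' \<subseteq> F" "countable F'" "\<Union>F' = \<Union>F" using Lindelof by blast
  have sets: "U \<inter> {a..b} \<in> sets (borel_on a b)" if "open U" for U
    using that by (auto simp: sets_restrict_space)
  have "AE s in N. \<forall>U\<in>F'. s \<notin> U"
  proof (rule AE_ball_countable'[OF _ F'(2)])
    fix U assume "U \<in> F'"
    then have "open U" "emeasure N (U \<inter> {a..b}) = 0" using F' by (auto simp: F_def)
    then show "AE s in N. s \<notin> U" by (intro AE_I[of _ _ "U \<inter> {a..b}"]) (auto simp: sets)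
  qed
  then have "AE s in N. s \<notin> \<Union>F" using F'(3) by (auto elim!: eventually_mono)
  moreover have "s \<in> S" if "s \<in> {a..b}" "s \<notin> \<Union>F" for s
  proof -
    have "total_variation a b \<nu> (U \<inter> {a..b}) > 0" if "open U" "s \<in> U" for U
    proof -
      have "U \<notin> F" using that \<open>s \<notin> \<Union>F\<close> by auto
      then have "ennreal (\<nu> (U \<inter> {a..b})) \<noteq> 0"
        using that sets[of U] by (simp add: F_def emeasure_N)
      then show ?thesis using that sets[of U] by (simp add: total_variation_eq ennreal_eq_0_iff)
    qed
    then show ?thesis using that assms by (auto simp: signed_measure_supp_def)
  qed
  ultimately show ?thesis by (auto intro: AE_mp)
qed

end

lemma max_subdiff_nonneg_measure:
  assumes "\<nu> \<in> max_subdiff a b u t"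
  shows "nonneg_measure a b \<nu>"
  using assms by unfold_locales (auto simp: max_subdiff_def signed_measures_def)

lemma max_subdiff_prob_space:
  assumes "\<nu> \<in> max_subdiff a b u t"
  shows "prob_space (as_measure a b \<nu>)"
proof -
  interpret nonneg_measure a b \<nu> by (rule max_subdiff_nonneg_measure[OF assms])
  have ab: "{a..b} \<in> sets (borel_on a b)" using sets.top[of "borel_on a b"] by simp
  have "signed_measure_norm a b \<nu> = 1" using assms by (simp add: max_subdiff_def)
  then show ?thesis
    by (intro prob_spaceI) (use ab in \<open>simp add: emeasure_N signed_measure_norm_def total_variation_eq\<close>)
qed

lemma max_subdiff_AE_maximizers:
  assumes "\<nu> \<in> max_subdiff a b u t"
  shows "AE s in as_measure a b \<nu>. s \<in> maximizers a u t"
  using nonneg_measure.AE_support[OF max_subdiff_nonneg_measure[OF assms]] assms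
  by (simp add: max_subdiff_def)

lemma max_subdiff_pairing:
  assumes "\<nu> \<in> max_subdiff a b u t"
  shows "pairing a b \<nu> h = (LINT s|as_measure a b \<nu>. h s)"
  by (rule nonneg_measure.pairing_eq[OF max_subdiff_nonneg_measure[OF assms]])

lemma max_subdiff_integrable:
  assumes \<nu>: "\<nu> \<in> max_subdiff a b u t" and h: "h \<in> C_space a b"
  shows "integrable (as_measure a b \<nu>) h"
proof -
  interpret prob_space "as_measure a b \<nu>" by (rule max_subdiff_prob_space[OF \<nu>])
  have "h \<in> borel_measurable (borel_on a b)"
    using h by (intro borel_measurable_continuous_on_restrict) (simp add: C_space_iff)
  then have m: "h \<in> borel_measurable (as_measure a b \<nu>)"
    by (simp cong: measurable_cong_sets)
  show ?thesis
    by (rule integrable_const_bound[of _ "max_norm a b h", OF AE_I2 m]) (simp add: max_norm_bounds[OF h])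
qed

section \<open>Dirac measures and the existence of a measurable selector\<close>

definition dirac :: "real \<Rightarrow> real \<Rightarrow> real \<Rightarrow> real set \<Rightarrow> real" where
  "dirac a b \<tau> = (\<lambda>A\<in>sets (borel_on a b). indicator A \<tau>)"

lemma dirac_apply: "A \<in> sets (borel_on a b) \<Longrightarrow> dirac a b \<tau> A = indicator A \<tau>"
  by (simp add: dirac_def)

lemma nonneg_measure_dirac: "nonneg_measure a b (dirac a b \<tau>)"
proof
  show "dirac a b \<tau> {} = 0" by (simp add: dirac_apply)
  fix A :: "nat \<Rightarrow> real set" assume A: "range A \<subseteq> sets (borel_on a b)" "disjoint_family A"
  then have "(\<Union>i. A i) \<in> sets (borel_on a b)" by auto
  moreover have "(\<lambda>i. indicator (A i) \<tau> :: real) sums indicator (\<Union>i. A i) \<tau>"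
    using A(2) by (intro indicator_sums) (auto simp: disjoint_family_on_def)
  ultimately show "(\<lambda>i. dirac a b \<tau> (A i)) sums dirac a b \<tau> (\<Union>i. A i)"
    using A(1) by (simp add: dirac_apply image_subset_iff)
qed (simp add: dirac_apply)

text \<open>Regularity is exact here: the compact and the open set can be chosen so that their
  difference avoids the atom, keeping \<open>\<tau>\<close> in the compact set if it lies in
  \<open>E\<close> and removing it from the open set otherwise.\<close>

lemma dirac_in_signed_measures:
  assumes "\<tau> \<in> {a..b}"
  shows "dirac a b \<tau> \<in> signed_measures a b"
proof -
  interpret nonneg_measure a b "dirac a b \<tau>" by (rule nonneg_measure_dirac)
  have sing: "{\<tau>} \<in> sets (borel_on a b)" "{a..b} \<in> sets (borel_on a b)"
    using assms by (auto simp: sets_restrict_space_iff)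
  have "\<exists>K U. compact K \<and> K \<subseteq> E \<and> E \<subseteq> U \<and>
           openin (top_of_set {a..b}) U \<and> total_variation a b (dirac a b \<tau>) (U - K) < e"
    if E: "E \<in> sets (borel_on a b)" and "e > 0" for E e
  proof (cases "\<tau> \<in> E")
    case True
    have "total_variation a b (dirac a b \<tau>) ({a..b} - {\<tau>}) = 0"
      using sing by (subst total_variation_eq) (auto simp: dirac_apply)
    then show ?thesis using True that sets.sets_into_space[OF E]
      by (intro exI[of _ "{\<tau>}"] exI[of _ "{a..b}"]) auto
  next
    case False
    have "total_variation a b (dirac a b \<tau>) ({a..b} - {\<tau>} - {}) = 0"
      using sing by (subst total_variation_eq) (auto simp: dirac_apply)
    moreover have "openin (top_of_set {a..b}) ({a..b} - {\<tau>})"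
      using openin_open_Int[OF open_Compl[OF closed_singleton[of \<tau>]], of "{a..b}"] by (simp add: Diff_eq)
    ultimately show ?thesis using False that sets.sets_into_space[OF E]
      by (intro exI[of _ "{}"] exI[of _ "{a..b} - {\<tau>}"]) auto
  qed
  then show ?thesis
    unfolding signed_measures_def using empty sums by (auto simp: dirac_def)
qed

text \<open>The open complement of \<open>\<tau>\<close> carries no mass, which excludes every other
  point from the support.\<close>

lemma dirac_in_max_subdiff:
  assumes "t \<in> {a..b}" "\<tau> \<in> maximizers a u t"
  shows "dirac a b \<tau> \<in> max_subdiff a b u t"
proof -
  interpret nonneg_measure a b "dirac a b \<tau>" by (rule nonneg_measure_dirac)
  have \<tau>: "\<tau> \<in> {a..b}" using assms by (auto simp: maximizers_def)
  have "x = \<tau>" if x: "x \<in> signed_measure_supp a b (dirac a b \<tau>)" for x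
  proof (rule ccontr)
    assume "x \<noteq> \<tau>"
    moreover have "(- {\<tau>}) \<inter> {a..b} \<in> sets (borel_on a b)"
      by (auto simp: sets_restrict_space)
    moreover have "open (- {\<tau>})" by auto
    ultimately have "0 < total_variation a b (dirac a b \<tau>) (- {\<tau>} \<inter> {a..b})"
      using x unfolding signed_measure_supp_def by blast
    with \<open>(- {\<tau>}) \<inter> {a..b} \<in> sets (borel_on a b)\<close> show False
      by (simp add: total_variation_eq dirac_apply)
  qed
  moreover have "signed_measure_norm a b (dirac a b \<tau>) = 1"
  proof -
    have "{a..b} \<in> sets (borel_on a b)" using sets.top[of "borel_on a b"] by simp
    then show ?thesis using \<tau> by (simp add: signed_measure_norm_def total_variation_eq dirac_apply)
  qed
  ultimately show ?thesis
    using assms dirac_in_signed_measures[OF \<tau>] nonneg unfolding max_subdiff_def by auto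
qed

lemma pairing_dirac:
  assumes "\<tau> \<in> {a..b}" "h \<in> C_space a b"
  shows "pairing a b (dirac a b \<tau>) h = h \<tau>"
proof -
  interpret nonneg_measure a b "dirac a b \<tau>" by (rule nonneg_measure_dirac)
  have ab: "{a..b} \<in> sets (borel_on a b)" "{a..b} - {\<tau>} \<in> sets (borel_on a b)"
    by (auto simp: sets_restrict_space_iff)
  interpret prob_space N
    by (intro prob_spaceI) (use ab assms in \<open>simp add: emeasure_N dirac_apply\<close>)
  have "h \<in> borel_measurable (borel_on a b)"
    using assms by (intro borel_measurable_continuous_on_restrict) (simp add: C_space_iff)
  then have "h \<in> borel_measurable N" by (simp cong: measurable_cong_sets)
  moreover have "AE s in N. h s = h \<tau>"
    using ab by (intro AE_I[of _ _ "{a..b} - {\<tau>}"]) (auto simp: emeasure_N dirac_apply)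
  ultimately have "(LINT s|N. h s) = (LINT s|N. h \<tau>)"
    by (intro integral_cong_AE) auto
  then show ?thesis by (simp add: pairing_eq prob_space[simplified])
qed

text \<open>The weak-star topology is pulled back from a product, so continuity is tested
  coordinatewise; the coordinate belonging to \<open>h\<close> is \<open>h\<close> itself.\<close>

lemma continuous_map_dirac:
  "continuous_map (top_of_set {a..b}) (weak_star_topology a b) (dirac a b)"
  unfolding weak_star_topology_def
proof (rule continuous_map_pullback')
  show "continuous_map (top_of_set {a..b}) (product_topology (\<lambda>_. euclideanreal) (C_space a b))
     ((\<lambda>\<nu>. \<lambda>h\<in>C_space a b. pairing a b \<nu> h) \<circ> dirac a b)"
    unfolding continuous_map_componentwise
  proof (intro conjI ballI)
    fix h assume h: "h \<in> C_space a b"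
    have "continuous_map (top_of_set {a..b}) euclideanreal h"
      using h by (simp add: C_space_iff)
    then show "continuous_map (top_of_set {a..b}) euclideanreal
        (\<lambda>x. ((\<lambda>\<nu>. \<lambda>h\<in>C_space a b. pairing a b \<nu> h) \<circ> dirac a b) x h)"
      by (rule continuous_map_eq) (simp add: h pairing_dirac)
  qed auto
  show "topspace (top_of_set {a..b}) \<subseteq> dirac a b -` signed_measures a b"
    using dirac_in_signed_measures by auto
qed

lemma continuous_map_pairing:
  assumes "h \<in> C_space a b"
  shows "continuous_map (weak_star_topology a b) euclideanreal (\<lambda>\<nu>. pairing a b \<nu> h)"
  unfolding weak_star_topology_def
  using continuous_map_pullback[OF continuous_map_product_projection[OF assms],
      of "signed_measures a b" "\<lambda>\<nu>. \<lambda>h\<in>C_space a b. pairing a b \<nu> h" "\<lambda>_. euclideanreal"]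
  by (simp add: o_def assms)

lemma dirac_first_maximizer_selector:
  "(\<lambda>(u, t). dirac a b (first_maximizer a u t)) \<in> measurable_selectors a b"
proof -
  let ?T = "CI_topology a b" and ?W = "weak_star_topology a b"
  let ?\<tau> = "\<lambda>(u, t). first_maximizer a u t" and ?\<mu> = "\<lambda>(u, t). dirac a b (first_maximizer a u t)"
  have \<tau>: "?\<tau> w \<in> {a..b}" if "w \<in> C_space a b \<times> {a..b}" for w
    using that first_maximizer(1)[of _ a b] by (force simp: maximizers_def)
  have "?\<mu> \<in> measurable (borel_of_topology ?T) (borel_of_topology ?W)"
  proof (rule measurable_borel_of_topology)
    show "?\<mu> \<in> space (borel_of_topology ?T) \<rightarrow> topspace ?W"
      using \<tau> continuous_map_funspace[OF continuous_map_dirac, of a b]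
      unfolding space_borel_of_topology topspace_CI by fastforce
    fix V assume "openin ?W V"
    then have "openin (top_of_set {a..b}) {x \<in> {a..b}. dirac a b x \<in> V}"
      using openin_continuous_map_preimage[OF continuous_map_dirac, of a b V] by simp
    \<comment> \<open>The first maximizer is measurable as a real function, so the relatively open
      set is replaced by an open set of reals with the same trace.\<close>
    then obtain O' where O': "open O'" "{x \<in> {a..b}. dirac a b x \<in> V} = {a..b} \<inter> O'"
      by (auto simp: openin_open)
    have "?\<mu> -` V \<inter> space (borel_of_topology ?T) = ?\<tau> -` O' \<inter> space (borel_of_topology ?T)"
      using O'(2) \<tau> unfolding space_borel_of_topology topspace_CI by fastforce
    then show "?\<mu> -` V \<inter> space (borel_of_topology ?T) \<in> sets (borel_of_topology ?T)"
      using measurable_sets[OF borel_measurable_first_maximizer[of a b], of O'] O'(1) by simp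
  qed
  then show ?thesis
    using first_maximizer(1)[of _ a b] dirac_in_max_subdiff
    unfolding measurable_selectors_def by auto
qed

text \<open>A composition of three maps: the continuous section at \<open>u\<close>, the Borel
  selector, and the weak-star continuous evaluation at \<open>h\<close>.\<close>

lemma selector_pairing_measurable:
  assumes \<mu>: "\<mu> \<in> measurable_selectors a b" and u: "u \<in> C_space a b" and h: "h \<in> C_space a b"
  shows "(\<lambda>t. pairing a b (\<mu> (u, t)) h) \<in> borel_measurable (lebesgue_on {a<..<b})"
proof -
  let ?T = "CI_topology a b"
  have "(\<lambda>t. (u, t)) \<in> measurable (borel_on a b) (borel_of_topology ?T)"
  proof (rule measurable_borel_of_topology)
    show "(\<lambda>t. (u, t)) \<in> space (borel_on a b) \<rightarrow> topspace ?T" 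
      using u unfolding topspace_CI by auto
    fix U assume U: "openin ?T U"
    have "continuous_map (top_of_set {a..b}) ?T (\<lambda>t. (u, t))"
      using u by (intro continuous_map_pairedI) (auto simp: C_space_def)
    from openin_continuous_map_preimage[OF this U]
    obtain S where "open S" "{t \<in> {a..b}. (u, t) \<in> U} = {a..b} \<inter> S" by (auto simp: openin_open)
    moreover have "(\<lambda>t. (u, t)) -` U \<inter> space (borel_on a b) = {t \<in> {a..b}. (u, t) \<in> U}" by auto
    ultimately show "(\<lambda>t. (u, t)) -` U \<inter> space (borel_on a b) \<in> sets (borel_on a b)"
      by (auto simp: sets_restrict_space)
  qed
  moreover have "\<mu> \<in> measurable (borel_of_topology ?T) (borel_of_topology (weak_star_topology a b))"
    using \<mu> by (simp add: measurable_selectors_def)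
  moreover have "(\<lambda>\<nu>. pairing a b \<nu> h) \<in> borel_measurable (borel_of_topology (weak_star_topology a b))"
    by (intro borel_measurable_if_continuous_map continuous_map_pairing h)
  ultimately have *: "(\<lambda>t. pairing a b (\<mu> (u, t)) h) \<in> borel_measurable (borel_on a b)"
    by (rule measurable_compose[OF measurable_compose])
  \<comment> \<open>The identity carries Borel measurability on the closed interval over to Lebesgue
    measurability on the open one.\<close>
  have "(\<lambda>x. x) \<in> measurable (lebesgue_on {a<..<b}) borel"
    by (intro measurable_restrict_space1) (simp add: measurable_completion)
  then have "(\<lambda>x. x) \<in> measurable (lebesgue_on {a<..<b}) (borel_on a b)"
    by (intro measurable_restrict_space2) auto
  from measurable_compose[OF this *] show ?thesis .
qed

section \<open>Lebesgue, Hoelder and Sobolev spaces\<close>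

lemma mem_Lp_class:
  assumes "f \<in> borel_measurable (lebesgue_on {a<..<b})"
  shows "g \<in> Lp_class a b f \<longleftrightarrow>
    g \<in> borel_measurable (lebesgue_on {a<..<b}) \<and> (AE t in lebesgue_on {a<..<b}. f t = g t)"
  using assms by (auto simp: Lp_class_def ae_eq_def)

lemma Lp_class_cong:
  assumes "f \<in> borel_measurable (lebesgue_on {a<..<b})" "g \<in> borel_measurable (lebesgue_on {a<..<b})"
    and "AE t in lebesgue_on {a<..<b}. f t = g t"
  shows "Lp_class a b f = Lp_class a b g"
proof (rule set_eqI)
  fix k
  have "(AE t in lebesgue_on {a<..<b}. f t = k t) \<longleftrightarrow> (AE t in lebesgue_on {a<..<b}. g t = k t)"
  proof
    assume "AE t in lebesgue_on {a<..<b}. f t = k t"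
    with assms(3) show "AE t in lebesgue_on {a<..<b}. g t = k t" by eventually_elim simp
  next
    assume "AE t in lebesgue_on {a<..<b}. g t = k t"
    with assms(3) show "AE t in lebesgue_on {a<..<b}. f t = k t" by eventually_elim simp
  qed
  then show "k \<in> Lp_class a b f \<longleftrightarrow> k \<in> Lp_class a b g"
    using assms by (simp add: mem_Lp_class)
qed

lemma Lp_class_cong_on:
  assumes "f \<in> borel_measurable (lebesgue_on {a<..<b})" "\<And>t. t \<in> {a<..<b} \<Longrightarrow> f t = g t"
  shows "Lp_class a b f = Lp_class a b g"
proof (rule Lp_class_cong[OF assms(1)])
  show "g \<in> borel_measurable (lebesgue_on {a<..<b})"
    using assms by (subst measurable_cong[of _ g f]) auto
qed (use assms in \<open>auto intro: AE_I2\<close>)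

text \<open>All pairs of representatives yield the same class, so the union in
  \<open>nsp_add\<close> runs over a nonempty family of equal sets and collapses.\<close>

lemma nsp_add_Lp_class:
  assumes f: "f \<in> borel_measurable (lebesgue_on {a<..<b})" and g: "g \<in> borel_measurable (lebesgue_on {a<..<b})"
  shows "nsp_add (Lp_space a b p) (Lp_class a b f) (Lp_class a b g) = Lp_class a b (\<lambda>t. f t + g t)"
proof -
  have "Lp_class a b (\<lambda>t. f' t + g' t) = Lp_class a b (\<lambda>t. f t + g t)"
    if "f' \<in> Lp_class a b f" "g' \<in> Lp_class a b g" for f' g'
    using that f g unfolding mem_Lp_class[OF f] mem_Lp_class[OF g]
    by (intro Lp_class_cong borel_measurable_add) (auto elim: eventually_elim2)
  then have "nsp_add (Lp_space a b p) (Lp_class a b f) (Lp_class a b g)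
      = (\<Union>f'\<in>Lp_class a b f. \<Union>g'\<in>Lp_class a b g. Lp_class a b (\<lambda>t. f t + g t))"
    by (simp add: Lp_space_def cong: SUP_cong_simp)
  moreover have "Lp_class a b f \<noteq> {}" "Lp_class a b g \<noteq> {}"
    using mem_Lp_class[OF f, of f] mem_Lp_class[OF g, of g] f g by auto
  ultimately show ?thesis by simp
qed

lemma nsp_scale_Lp_class:
  assumes f: "f \<in> borel_measurable (lebesgue_on {a<..<b})"
  shows "nsp_scale (Lp_space a b p) c (Lp_class a b f) = Lp_class a b (\<lambda>t. c * f t)"
proof -
  have "Lp_class a b (\<lambda>t. c * f' t) = Lp_class a b (\<lambda>t. c * f t)" if "f' \<in> Lp_class a b f" for f'
  proof (intro Lp_class_cong borel_measurable_times)
    have "AE t in lebesgue_on {a<..<b}. f t = f' t" using that mem_Lp_class[OF f] by blast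
    then show "AE t in lebesgue_on {a<..<b}. c * f' t = c * f t" by eventually_elim simp
  qed (use that f mem_Lp_class[OF f] in auto)
  then have "nsp_scale (Lp_space a b p) c (Lp_class a b f)
      = (\<Union>f'\<in>Lp_class a b f. Lp_class a b (\<lambda>t. c * f t))"
    by (simp add: Lp_space_def cong: SUP_cong_simp)
  moreover have "Lp_class a b f \<noteq> {}"
    using mem_Lp_class[OF f, of f] f by auto
  ultimately show ?thesis by simp
qed

lemma nsp_diff_Lp_class:
  assumes "f \<in> borel_measurable (lebesgue_on {a<..<b})" "g \<in> borel_measurable (lebesgue_on {a<..<b})"
  shows "nsp_diff (Lp_space a b p) (Lp_class a b f) (Lp_class a b g) = Lp_class a b (\<lambda>t. f t - g t)"
  using assms unfolding nsp_diff_def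
  by (simp add: nsp_scale_Lp_class nsp_add_Lp_class)

lemma nsp_norm_Lp_class:
  assumes f: "f \<in> borel_measurable (lebesgue_on {a<..<b})"
  shows "nsp_norm (Lp_space a b (ereal q)) (Lp_class a b f) = Lp_seminorm a b (ereal q) f"
proof -
  define g where "g = (SOME g. g \<in> Lp_class a b f)"
  have "g \<in> Lp_class a b f"
    unfolding g_def by (rule someI[of _ f]) (use f in \<open>simp add: mem_Lp_class\<close>)
  then have g: "g \<in> borel_measurable (lebesgue_on {a<..<b})" "AE t in lebesgue_on {a<..<b}. f t = g t"
    by (simp_all add: mem_Lp_class[OF f])
  have "(LINT t|lebesgue_on {a<..<b}. \<bar>g t\<bar> powr q) = (LINT t|lebesgue_on {a<..<b}. \<bar>f t\<bar> powr q)"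
    using f g by (intro integral_cong_AE) auto
  then show ?thesis by (simp add: Lp_space_def Lp_seminorm_def flip: g_def)
qed

lemma Lp_class_in_carrier: "f \<in> Lp_functions a b p \<Longrightarrow> Lp_class a b f \<in> nsp_carrier (Lp_space a b p)"
  by (auto simp: Lp_space_def Lp_class_def intro: quotientI)

section \<open>Membership and seminorm estimates in Lebesgue spaces\<close>

lemma measure_space_Ioo: "a < b \<Longrightarrow> measure (lebesgue_on {a<..<b::real}) {a<..<b} = b - a"
  by (simp add: measure_restrict_space)

lemma Lp_functions_if_bounded:
  assumes ab: "a < b" and p: "1 \<le> p" and f: "f \<in> borel_measurable (lebesgue_on {a<..<b})"
    and K: "\<And>t. t \<in> {a<..<b} \<Longrightarrow> \<bar>f t\<bar> \<le> K"
  shows "f \<in> Lp_functions a b p"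
proof (cases "p = \<infinity>")
  case True
  have "esssup (lebesgue_on {a<..<b}) (\<lambda>t. ereal \<bar>f t\<bar>) \<le> ereal K"
    using f K by (intro esssup_I AE_I2) auto
  then show ?thesis using f True by (auto simp: Lp_functions_def intro: le_less_trans)
next
  case False
  then obtain r where r: "p = ereal r" "1 \<le> r" using p by (cases p) auto
  have "integrable (lebesgue_on {a<..<b}) (\<lambda>t. \<bar>f t\<bar> powr r)"
    using f K r by (intro integrable_Ioo_if_bounded[of _ _ _ "K powr r"]) (auto intro!: powr_mono2)
  then show ?thesis using f r by (simp add: Lp_functions_def)
qed

lemma Lp_seminorm_le_if_bounded:
  assumes ab: "a < b" and q: "1 \<le> q" and f: "f \<in> borel_measurable (lebesgue_on {a<..<b})"
    and K: "\<And>t. t \<in> {a<..<b} \<Longrightarrow> \<bar>f t\<bar> \<le> K"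
  shows "Lp_seminorm a b (ereal q) f \<le> K * (b - a) powr (1 / q)"
proof -
  let ?M = "lebesgue_on {a<..<b}"
  interpret finite_measure ?M by (rule finite_measure_Ioo)
  \<comment> \<open>The midpoint shows that the bound is attained against at least one value, hence
    nonnegative.\<close>
  have K0: "K \<ge> 0" using K[of "(a + b) / 2"] ab by auto
  have "(LINT t|?M. \<bar>f t\<bar> powr q) \<le> (LINT t|?M. K powr q)"
    using Lp_functions_if_bounded[OF ab _ f K, of "ereal q"] q K
    by (intro integral_mono) (auto simp: Lp_functions_def intro!: powr_mono2)
  also have "\<dots> = K powr q * (b - a)"
    using measure_space_Ioo[OF ab] by simp
  finally have "(LINT t|?M. \<bar>f t\<bar> powr q) powr (1 / q) \<le> (K powr q * (b - a)) powr (1 / q)"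
    using q by (intro powr_mono2) auto
  also have "\<dots> = K * (b - a) powr (1 / q)"
    using q K0 ab by (simp add: powr_mult powr_powr)
  finally show ?thesis by (simp add: Lp_seminorm_def)
qed

lemma Lp_seminorm_divide:
  assumes "0 < N" "1 \<le> q"
  shows "Lp_seminorm a b (ereal q) (\<lambda>t. f t / N) = Lp_seminorm a b (ereal q) f / N"
proof -
  have "(LINT t|lebesgue_on {a<..<b}. \<bar>f t / N\<bar> powr q) = (LINT t|lebesgue_on {a<..<b}. \<bar>f t\<bar> powr q) / N powr q"
    using assms by (simp add: abs_divide powr_divide)
  then show ?thesis using assms by (simp add: Lp_seminorm_def powr_divide powr_powr)
qed

lemma Lp_functions_add:
  assumes ab: "a < b" and p: "1 < p" and f: "f \<in> Lp_functions a b p" and g: "g \<in> Lp_functions a b p"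
  shows "(\<lambda>t. f t + g t) \<in> Lp_functions a b p"
proof -
  let ?M = "lebesgue_on {a<..<b}"
  have m: "f \<in> borel_measurable ?M" "g \<in> borel_measurable ?M"
    using f g by (auto dest: Lp_functions_measurable)
  show ?thesis
  proof (cases "p = \<infinity>")
    case True
    have "esssup ?M (\<lambda>t. ereal \<bar>f t + g t\<bar>) \<le> ereal (Lp_seminorm a b \<infinity> f + Lp_seminorm a b \<infinity> g)"
    proof (rule esssup_I)
      show "AE t in ?M. ereal \<bar>f t + g t\<bar> \<le> ereal (Lp_seminorm a b \<infinity> f + Lp_seminorm a b \<infinity> g)"
        using AE_le_Lp_seminorm_infinity(1)[OF ab f[unfolded True]] AE_le_Lp_seminorm_infinity(1)[OF ab g[unfolded True]]
        by eventually_elim auto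
    qed (use m in simp)
    then show ?thesis using m True by (auto simp: Lp_functions_def intro: le_less_trans)
  next
    case False
    then obtain r where r: "p = ereal r" "1 < r" using p by (cases p) auto
    have "integrable ?M (\<lambda>t. \<bar>f t + g t\<bar> powr r)"
    proof (rule Bochner_Integration.integrable_bound)
      show "integrable ?M (\<lambda>t. 2 powr r * (\<bar>f t\<bar> powr r + \<bar>g t\<bar> powr r))"
        using f g r by (intro integrable_mult_right Bochner_Integration.integrable_add) (auto simp: Lp_functions_def)
      show "(\<lambda>t. \<bar>f t + g t\<bar> powr r) \<in> borel_measurable ?M" using m by simp
      \<comment> \<open>Only membership is at stake, so a crude bound through the larger of the two
        values takes the place of Minkowski's inequality.\<close>
      have "\<bar>x + y\<bar> powr r \<le> 2 powr r * (\<bar>x\<bar> powr r + \<bar>y\<bar> powr r)" for x y :: real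
      proof -
        have "\<bar>x + y\<bar> powr r \<le> (2 * max \<bar>x\<bar> \<bar>y\<bar>) powr r"
          using r by (intro powr_mono2) auto
        also have "\<dots> = 2 powr r * max \<bar>x\<bar> \<bar>y\<bar> powr r" by (simp add: powr_mult)
        also have "\<dots> \<le> 2 powr r * (\<bar>x\<bar> powr r + \<bar>y\<bar> powr r)"
          by (intro mult_left_mono) (auto simp: max_def)
        finally show ?thesis .
      qed
      then show "AE t in ?M. norm (\<bar>f t + g t\<bar> powr r) \<le> norm (2 powr r * (\<bar>f t\<bar> powr r + \<bar>g t\<bar> powr r))"
        by (intro AE_I2) simp
    qed
    then show ?thesis using m r by (simp add: Lp_functions_def)
  qed
qed

lemma Lp_functions_scale:
  assumes ab: "a < b" and p: "1 < p" and f: "f \<in> Lp_functions a b p"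
  shows "(\<lambda>t. c * f t) \<in> Lp_functions a b p"
proof -
  let ?M = "lebesgue_on {a<..<b}"
  have m: "f \<in> borel_measurable ?M" using f by (auto dest: Lp_functions_measurable)
  show ?thesis
  proof (cases "p = \<infinity>")
    case True
    have "esssup ?M (\<lambda>t. ereal \<bar>c * f t\<bar>) \<le> ereal (\<bar>c\<bar> * Lp_seminorm a b \<infinity> f)"
    proof (rule esssup_I)
      show "AE t in ?M. ereal \<bar>c * f t\<bar> \<le> ereal (\<bar>c\<bar> * Lp_seminorm a b \<infinity> f)"
        using AE_le_Lp_seminorm_infinity(1)[OF ab f[unfolded True]]
        by eventually_elim (auto simp: abs_mult intro: mult_left_mono)
    qed (use m in simp)
    then show ?thesis using m True by (auto simp: Lp_functions_def intro: le_less_trans)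
  next
    case False
    then obtain r where r: "p = ereal r" "1 < r" using p by (cases p) auto
    have "integrable ?M (\<lambda>t. \<bar>c\<bar> powr r * \<bar>f t\<bar> powr r)"
      using f r by (intro integrable_mult_right) (auto simp: Lp_functions_def)
    then show ?thesis using m r by (simp add: Lp_functions_def abs_mult powr_mult)
  qed
qed

section \<open>Hoelder and Sobolev spaces as vector spaces of continuous functions\<close>

lemma hoelder_quotient_le:
  assumes "u \<in> nsp_carrier (hoelder_space a b \<alpha>)" "s \<in> {a..b}" "t \<in> {a..b}"
  shows "\<bar>u t - u s\<bar> \<le> nsp_norm (hoelder_space a b \<alpha>) u * \<bar>t - s\<bar> powr \<alpha>"
proof (cases "s = t")
  case False
  have "\<bar>u t - u s\<bar> / \<bar>t - s\<bar> powr \<alpha> \<le> Sup (hoelder_quotients a b \<alpha> u)"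
    using assms False by (intro cSup_upper) (auto simp: hoelder_space_def hoelder_quotients_def)
  also have "\<dots> \<le> nsp_norm (hoelder_space a b \<alpha>) u" by (simp add: hoelder_space_def)
  finally show ?thesis using False by (simp add: divide_le_eq)
qed simp

text \<open>Provides an element of the set, so that its \<open>Sup\<close> is a genuine supremum and
  nonnegative.\<close>

lemma endpoints_in_hoelder_quotients:
  assumes "a < b"
  shows "\<bar>u b - u a\<bar> / \<bar>b - a\<bar> powr \<alpha> \<in> hoelder_quotients a b \<alpha> u"
  unfolding hoelder_quotients_def using assms by (intro CollectI exI[of _ a] exI[of _ b]) auto

lemma hoelder_norm_bounds:
  assumes "a < b" "u \<in> nsp_carrier (hoelder_space a b \<alpha>)"
  shows "0 \<le> nsp_norm (hoelder_space a b \<alpha>) u" "\<bar>u a\<bar> \<le> nsp_norm (hoelder_space a b \<alpha>) u"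
proof -
  have "0 \<le> \<bar>u b - u a\<bar> / \<bar>b - a\<bar> powr \<alpha>" by simp
  also have "\<dots> \<le> Sup (hoelder_quotients a b \<alpha> u)"
    using assms by (intro cSup_upper endpoints_in_hoelder_quotients) (simp_all add: hoelder_space_def)
  finally show "0 \<le> nsp_norm (hoelder_space a b \<alpha>) u" "\<bar>u a\<bar> \<le> nsp_norm (hoelder_space a b \<alpha>) u"
    by (simp_all add: hoelder_space_def)
qed

lemma hoelder_spaceI:
  assumes "a < b" "u \<in> C_space a b"
    and K: "\<And>s t. s \<in> {a..b} \<Longrightarrow> t \<in> {a..b} \<Longrightarrow> \<bar>u t - u s\<bar> \<le> K * \<bar>t - s\<bar> powr \<alpha>"
  shows "u \<in> nsp_carrier (hoelder_space a b \<alpha>)" "nsp_norm (hoelder_space a b \<alpha>) u \<le> \<bar>u a\<bar> + K"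
proof -
  have le: "x \<le> K" if "x \<in> hoelder_quotients a b \<alpha> u" for x
    using that K by (auto simp: hoelder_quotients_def divide_le_eq)
  show "u \<in> nsp_carrier (hoelder_space a b \<alpha>)"
    using assms le by (auto simp: hoelder_space_def intro!: bdd_aboveI[of _ K])
  have "hoelder_quotients a b \<alpha> u \<noteq> {}"
    using endpoints_in_hoelder_quotients[OF assms(1)] by blast
  then have "Sup (hoelder_quotients a b \<alpha> u) \<le> K" using le by (rule cSup_least)
  then show "nsp_norm (hoelder_space a b \<alpha>) u \<le> \<bar>u a\<bar> + K" by (simp add: hoelder_space_def)
qed

lemma hoelder_C_space: "u \<in> nsp_carrier (hoelder_space a b \<alpha>) \<Longrightarrow> u \<in> C_space a b"
  by (simp add: hoelder_space_def)

lemma max_norm_le_hoelder_norm: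
  assumes "a < b" "0 \<le> \<alpha>" "u \<in> nsp_carrier (hoelder_space a b \<alpha>)"
  shows "max_norm a b u \<le> (1 + (b - a) powr \<alpha>) * nsp_norm (hoelder_space a b \<alpha>) u"
proof (rule max_norm_le)
  let ?N = "nsp_norm (hoelder_space a b \<alpha>) u"
  fix x assume x: "x \<in> {a..b}"
  have "\<bar>u x - u a\<bar> \<le> ?N * \<bar>x - a\<bar> powr \<alpha>"
    using assms(1) x by (intro hoelder_quotient_le[OF assms(3)]) auto
  also have "\<dots> \<le> ?N * (b - a) powr \<alpha>"
    using x assms by (intro mult_left_mono powr_mono2 hoelder_norm_bounds(1)) auto
  finally show "\<bar>u x\<bar> \<le> (1 + (b - a) powr \<alpha>) * ?N"
    using hoelder_norm_bounds(2)[OF assms(1,3)] by (simp add: algebra_simps)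
qed (use assms in simp)

lemma C_space_add:
  assumes "u \<in> C_space a b" "v \<in> C_space a b"
  shows "(\<lambda>t\<in>{a..b}. u t + v t) \<in> C_space a b"
proof -
  have "continuous_on {a..b} (\<lambda>t. u t + v t)"
    using assms by (intro continuous_on_add) (simp_all add: C_space_iff)
  then have "continuous_on {a..b} (\<lambda>t\<in>{a..b}. u t + v t)"
    by (rule continuous_on_eq) simp
  then show ?thesis by (simp add: C_space_iff)
qed

lemma C_space_scale:
  assumes "u \<in> C_space a b"
  shows "(\<lambda>t\<in>{a..b}. c * u t) \<in> C_space a b"
proof -
  have "continuous_on {a..b} (\<lambda>t. c * u t)"
    using assms by (intro continuous_on_mult_left) (simp add: C_space_iff)
  then have "continuous_on {a..b} (\<lambda>t\<in>{a..b}. c * u t)"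
    by (rule continuous_on_eq) simp
  then show ?thesis by (simp add: C_space_iff)
qed

lemma hoelder_space_add:
  assumes "a < b" "u \<in> nsp_carrier (hoelder_space a b \<alpha>)" "v \<in> nsp_carrier (hoelder_space a b \<alpha>)"
  shows "(\<lambda>t\<in>{a..b}. u t + v t) \<in> nsp_carrier (hoelder_space a b \<alpha>)"
proof (rule hoelder_spaceI(1)[OF assms(1)])
  show "(\<lambda>t\<in>{a..b}. u t + v t) \<in> C_space a b"
    using assms by (intro C_space_add hoelder_C_space)
  fix s t assume st: "s \<in> {a..b}" "t \<in> {a..b}"
  show "\<bar>(\<lambda>t\<in>{a..b}. u t + v t) t - (\<lambda>t\<in>{a..b}. u t + v t) s\<bar>
    \<le> (nsp_norm (hoelder_space a b \<alpha>) u + nsp_norm (hoelder_space a b \<alpha>) v) * \<bar>t - s\<bar> powr \<alpha>"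
    using hoelder_quotient_le[OF assms(2) st] hoelder_quotient_le[OF assms(3) st] st
    by (simp add: algebra_simps)
qed

lemma hoelder_space_scale:
  assumes "a < b" "u \<in> nsp_carrier (hoelder_space a b \<alpha>)"
  shows "(\<lambda>t\<in>{a..b}. c * u t) \<in> nsp_carrier (hoelder_space a b \<alpha>)"
proof (rule hoelder_spaceI(1)[OF assms(1)])
  show "(\<lambda>t\<in>{a..b}. c * u t) \<in> C_space a b"
    using assms by (intro C_space_scale hoelder_C_space)
  fix s t assume st: "s \<in> {a..b}" "t \<in> {a..b}"
  have "\<bar>c * u t - c * u s\<bar> = \<bar>c\<bar> * \<bar>u t - u s\<bar>" by (simp add: abs_mult flip: right_diff_distrib)
  also have "\<dots> \<le> \<bar>c\<bar> * (nsp_norm (hoelder_space a b \<alpha>) u * \<bar>t - s\<bar> powr \<alpha>)"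
    by (intro mult_left_mono hoelder_quotient_le[OF assms(2) st]) simp
  finally show "\<bar>(\<lambda>t\<in>{a..b}. c * u t) t - (\<lambda>t\<in>{a..b}. c * u t) s\<bar>
    \<le> (\<bar>c\<bar> * nsp_norm (hoelder_space a b \<alpha>) u) * \<bar>t - s\<bar> powr \<alpha>"
    using st by (simp add: mult.assoc)
qed

lemma sobolev_space_subset_hoelder_space:
  assumes "a < b" "1 < p" "u \<in> nsp_carrier (sobolev_space a b p)"
  shows "u \<in> nsp_carrier (hoelder_space a b (sobolev_exponent p))"
    and "nsp_norm (hoelder_space a b (sobolev_exponent p)) u \<le> nsp_norm (sobolev_space a b p) u"
proof -
  define g where "g = (SOME g. g \<in> Lp_functions a b p \<and> weak_derivative a b u g)"
  have u: "u \<in> C_space a b" "\<exists>g. g \<in> Lp_functions a b p \<and> weak_derivative a b u g"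
    using assms(3) by (auto simp: sobolev_space_def)
  have g: "g \<in> Lp_functions a b p" "weak_derivative a b u g"
    using someI_ex[OF u(2)] by (auto simp: g_def)
  \<comment> \<open>The increment bound holds for every weak derivative in the Lebesgue space, in
    particular for the one that \<open>SOME\<close> picks in the norm.\<close>
  note inc = sobolev_increment[OF assms(1,2) _ g]
  show "u \<in> nsp_carrier (hoelder_space a b (sobolev_exponent p))"
    using u by (intro hoelder_spaceI(1)[OF assms(1) _ inc]) (auto simp: C_space_iff)
  have "nsp_norm (hoelder_space a b (sobolev_exponent p)) u \<le> \<bar>u a\<bar> + Lp_seminorm a b p g"
    using u by (intro hoelder_spaceI(2)[OF assms(1) _ inc]) (auto simp: C_space_iff)
  then show "nsp_norm (hoelder_space a b (sobolev_exponent p)) u \<le> nsp_norm (sobolev_space a b p) u"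
    by (simp add: sobolev_space_def g_def)
qed

lemma test_function_continuous:
  assumes "test_function a b \<phi>"
  shows "continuous_on S \<phi>" "continuous_on S (deriv \<phi>)"
proof -
  have d: "(deriv ^^ n) \<phi> differentiable at x" for n x using assms by (simp add: test_function_def)
  show "continuous_on S \<phi>"
    using d[of 0] by (auto intro!: continuous_at_imp_continuous_on differentiable_imp_continuous_within)
  show "continuous_on S (deriv \<phi>)"
    using d[of 1] by (auto intro!: continuous_at_imp_continuous_on differentiable_imp_continuous_within)
qed

lemma integral_Ioo_cong:
  assumes "\<And>x. x \<in> {a<..<b::real} \<Longrightarrow> f x = g x"
  shows "(LINT x|lebesgue_on {a<..<b}. f x) = (LINT x|lebesgue_on {a<..<b}. g x)"
  using assms by (intro Bochner_Integration.integral_cong) auto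

lemma C_space_Lp_functions:
  assumes "a < b" "1 < p" "u \<in> C_space a b"
  shows "u \<in> Lp_functions a b p"
proof (rule Lp_functions_if_bounded[OF assms(1)])
  show "u \<in> borel_measurable (lebesgue_on {a<..<b})"
    using assms(3) by (intro measurable_Ioo_if_continuous) (simp add: C_space_iff)
  show "\<bar>u t\<bar> \<le> max_norm a b u" if "t \<in> {a<..<b}" for t
    using that by (intro max_norm_bounds[OF assms(3)]) auto
qed (use assms in simp)

lemma sobolev_space_add:
  assumes ab: "a < b" and p: "1 < p" and "u \<in> nsp_carrier (sobolev_space a b p)" "v \<in> nsp_carrier (sobolev_space a b p)"
  shows "(\<lambda>t\<in>{a..b}. u t + v t) \<in> nsp_carrier (sobolev_space a b p)"
proof -
  let ?M = "lebesgue_on {a<..<b}"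
  obtain f g where f: "f \<in> Lp_functions a b p" "weak_derivative a b u f"
    and g: "g \<in> Lp_functions a b p" "weak_derivative a b v g"
    and uv: "u \<in> C_space a b" "v \<in> C_space a b"
    using assms by (auto simp: sobolev_space_def)
  have "weak_derivative a b (\<lambda>t\<in>{a..b}. u t + v t) (\<lambda>t. f t + g t)"
    unfolding weak_derivative_def
  proof (intro allI impI)
    fix \<phi> assume \<phi>: "test_function a b \<phi>"
    note int = integrable_Ioo_mult_continuous[OF Lp_functions_integrable[OF ab p]]
    have "(LINT t|?M. (\<lambda>t\<in>{a..b}. u t + v t) t * deriv \<phi> t) = (LINT t|?M. u t * deriv \<phi> t + v t * deriv \<phi> t)"
      by (intro integral_Ioo_cong) (auto simp: algebra_simps)
    also have "\<dots> = (LINT t|?M. u t * deriv \<phi> t) + (LINT t|?M. v t * deriv \<phi> t)"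
      using uv by (intro Bochner_Integration.integral_add int C_space_Lp_functions ab p test_function_continuous[OF \<phi>])
    also have "\<dots> = - ((LINT t|?M. f t * \<phi> t) + (LINT t|?M. g t * \<phi> t))"
      using f g \<phi> by (simp add: weak_derivative_def)
    also have "(LINT t|?M. f t * \<phi> t) + (LINT t|?M. g t * \<phi> t) = (LINT t|?M. f t * \<phi> t + g t * \<phi> t)"
      using f g by (intro Bochner_Integration.integral_add[symmetric] int test_function_continuous[OF \<phi>])
    finally show "(LINT t|?M. (\<lambda>t\<in>{a..b}. u t + v t) t * deriv \<phi> t) = - (LINT t|?M. (f t + g t) * \<phi> t)"
      by (simp add: algebra_simps)
  qed
  then show ?thesis
    using C_space_add[OF uv] C_space_Lp_functions[OF ab p C_space_add[OF uv]] Lp_functions_add[OF ab p f(1) g(1)]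
    by (auto simp: sobolev_space_def)
qed

lemma sobolev_space_scale:
  assumes ab: "a < b" and p: "1 < p" and "u \<in> nsp_carrier (sobolev_space a b p)"
  shows "(\<lambda>t\<in>{a..b}. c * u t) \<in> nsp_carrier (sobolev_space a b p)"
proof -
  let ?M = "lebesgue_on {a<..<b}"
  obtain f where f: "f \<in> Lp_functions a b p" "weak_derivative a b u f" and u: "u \<in> C_space a b"
    using assms by (auto simp: sobolev_space_def)
  have "weak_derivative a b (\<lambda>t\<in>{a..b}. c * u t) (\<lambda>t. c * f t)"
    unfolding weak_derivative_def
  proof (intro allI impI)
    fix \<phi> assume \<phi>: "test_function a b \<phi>"
    have "(LINT t|?M. (\<lambda>t\<in>{a..b}. c * u t) t * deriv \<phi> t) = (LINT t|?M. c * (u t * deriv \<phi> t))"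
      by (intro integral_Ioo_cong) auto
    also have "\<dots> = c * (LINT t|?M. u t * deriv \<phi> t)" by (rule integral_mult_right_zero)
    also have "\<dots> = - (c * (LINT t|?M. f t * \<phi> t))" using f \<phi> by (simp add: weak_derivative_def)
    also have "c * (LINT t|?M. f t * \<phi> t) = (LINT t|?M. c * (f t * \<phi> t))"
      by (rule integral_mult_right_zero[symmetric])
    finally show "(LINT t|?M. (\<lambda>t\<in>{a..b}. c * u t) t * deriv \<phi> t) = - (LINT t|?M. (c * f t) * \<phi> t)"
      by (simp add: mult.assoc)
  qed
  then show ?thesis
    using C_space_scale[OF u] C_space_Lp_functions[OF ab p C_space_scale[OF u]] Lp_functions_scale[OF ab p f(1)]
    by (auto simp: sobolev_space_def)
qed

section \<open>The remainder\<close>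

text \<open>Almost everywhere for \<nu> the point \<tau> maximizes \<open>v\<close>, so
  \<open>h \<tau> = running_max a v t - u \<tau>\<close>. Integrating this identity leaves minus the
  mean of the gap as the remainder, and the gap lies between 0 and \<open>c\<close>.\<close>

lemma remainder_le_gap:
  assumes u: "u \<in> C_space a b" and h: "h \<in> C_space a b" and v: "v \<in> C_space a b"
    and v_eq: "\<And>x. x \<in> {a..b} \<Longrightarrow> v x = u x + h x"
    and t: "t \<in> {a..b}" and \<nu>: "\<nu> \<in> max_subdiff a b v t"
    and gap: "\<And>\<tau>. \<tau> \<in> maximizers a v t \<Longrightarrow> running_max a u t - u \<tau> \<le> c"
  shows "\<bar>running_max a v t - running_max a u t - pairing a b \<nu> h\<bar> \<le> c"
proof -
  let ?N = "as_measure a b \<nu>"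
  interpret prob_space ?N by (rule max_subdiff_prob_space[OF \<nu>])
  note ae = max_subdiff_AE_maximizers[OF \<nu>]
  note int = max_subdiff_integrable[OF \<nu> h] max_subdiff_integrable[OF \<nu> u]
  have "expectation h = expectation (\<lambda>\<tau>. running_max a v t - u \<tau>)"
  proof (rule integral_cong_AE)
    show "AE \<tau> in ?N. h \<tau> = running_max a v t - u \<tau>"
      using ae by eventually_elim (use v_eq t in \<open>auto simp: maximizers_def algebra_simps\<close>)
  qed (use int in auto)
  also have "\<dots> = running_max a v t - expectation u"
    using int prob_space[simplified] by simp
  finally have pairing: "pairing a b \<nu> h = running_max a v t - expectation u"
    by (simp add: max_subdiff_pairing[OF \<nu>])
  have gap_int: "integrable ?N (\<lambda>\<tau>. running_max a u t - u \<tau>)" using int by simp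
  have "expectation (\<lambda>\<tau>. running_max a u t - u \<tau>) = running_max a u t - expectation u"
    using int prob_space[simplified] by simp
  moreover have "expectation (\<lambda>\<tau>. running_max a u t - u \<tau>) \<le> c"
    using ae gap by (intro integral_le_const[OF gap_int]) (auto elim: eventually_mono)
  moreover have "0 \<le> expectation (\<lambda>\<tau>. running_max a u t - u \<tau>)"
  proof (rule integral_ge_const[OF gap_int])
    show "AE \<tau> in ?N. 0 \<le> running_max a u t - u \<tau>"
      using ae by eventually_elim (use running_max_upper[OF u t] in \<open>auto simp: maximizers_def\<close>)
  qed
  ultimately show ?thesis using pairing by simp
qed

text \<open>The points at distance at least \<open>e\<close> from all maximizers form a compact set
  \<open>K\<close>, on which \<open>u\<close> attains a value strictly below the running maximum;
  this deficit serves as \<open>d\<close>. If \<open>K\<close> is empty, any positive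
  \<open>d\<close> will do.\<close>

lemma maximizers_near:
  assumes u: "u \<in> C_space a b" and t: "t \<in> {a..b}" and "0 < e"
  obtains d where "0 < d"
    "\<And>\<tau>. \<tau> \<in> {a..t} \<Longrightarrow> running_max a u t - u \<tau> < d \<Longrightarrow> \<exists>\<sigma>\<in>maximizers a u t. \<bar>\<tau> - \<sigma>\<bar> < e"
proof -
  define K where "K = {a..t} - (\<Union>\<sigma>\<in>maximizers a u t. ball \<sigma> e)"
  have "compact K" unfolding K_def by (intro compact_diff) auto
  have near: "\<exists>\<sigma>\<in>maximizers a u t. \<bar>\<tau> - \<sigma>\<bar> < e" if \<tau>: "\<tau> \<in> {a..t}" "\<tau> \<notin> K" for \<tau>
  proof -
    obtain \<sigma> where "\<sigma> \<in> maximizers a u t" "\<tau> \<in> ball \<sigma> e" using \<tau> unfolding K_def by blast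
    then show ?thesis by (intro bexI[of _ \<sigma>]) (auto simp: dist_real_def)
  qed
  show ?thesis
  proof (cases "K = {}")
    case True
    then show ?thesis using near by (intro that[of 1]) auto
  next
    case False
    have "continuous_on {a..b} u" using u by (simp add: C_space_iff)
    then have "continuous_on K u" by (rule continuous_on_subset) (use t in \<open>auto simp: K_def\<close>)
    from continuous_attains_sup[OF \<open>compact K\<close> False this]
    obtain \<tau>0 where \<tau>0: "\<tau>0 \<in> K" "\<forall>\<tau>\<in>K. u \<tau> \<le> u \<tau>0" by (rule bexE)
    have \<tau>0_in: "\<tau>0 \<in> {a..t}" using \<tau>0(1) by (simp add: K_def)
    have "\<tau>0 \<notin> maximizers a u t" using \<tau>0(1) \<open>0 < e\<close> unfolding K_def by force
    then have less: "u \<tau>0 < running_max a u t"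
      using running_max_upper[OF u t \<tau>0_in] \<tau>0_in by (simp add: maximizers_def)
    show ?thesis
    proof (rule that[of "running_max a u t - u \<tau>0"])
      fix \<tau> assume \<tau>: "\<tau> \<in> {a..t}" "running_max a u t - u \<tau> < running_max a u t - u \<tau>0"
      then have "\<not> u \<tau> \<le> u \<tau>0" by simp
      then have "\<tau> \<notin> K" using \<tau>0(2) by blast
      then show "\<exists>\<sigma>\<in>maximizers a u t. \<bar>\<tau> - \<sigma>\<bar> < e" by (rule near[OF \<tau>(1)])
    qed (use less in simp)
  qed
qed

lemma gap_le_increment:
  assumes u: "u \<in> C_space a b" and v: "v \<in> C_space a b"
    and v_eq: "\<And>x. x \<in> {a..b} \<Longrightarrow> v x = u x + h x"
    and t: "t \<in> {a..b}" and \<tau>: "\<tau> \<in> maximizers a v t" and \<sigma>: "\<sigma> \<in> maximizers a u t"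
  shows "running_max a u t - u \<tau> \<le> h \<tau> - h \<sigma>"
proof -
  have "v \<sigma> \<le> v \<tau>"
    using running_max_upper[OF v t, of \<sigma>] \<tau> \<sigma> by (auto simp: maximizers_def)
  moreover have "v \<sigma> = u \<sigma> + h \<sigma>" "v \<tau> = u \<tau> + h \<tau>"
    by (rule v_eq, use \<tau> \<sigma> t in \<open>simp add: maximizers_def\<close>)+
  ultimately show ?thesis using \<sigma> by (simp add: maximizers_def)
qed

section \<open>Uniform estimates of the remainder in the Hoelder norm\<close>

locale hoelder_setting =
  fixes a b q \<alpha> :: real
  assumes ab: "a < b" and q: "1 \<le> q" and \<alpha>: "0 < \<alpha>"
begin

abbreviation "H \<equiv> nsp_carrier (hoelder_space a b \<alpha>)"
abbreviation "hnorm \<equiv> nsp_norm (hoelder_space a b \<alpha>)"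

definition add_fun :: "(real \<Rightarrow> real) \<Rightarrow> (real \<Rightarrow> real) \<Rightarrow> real \<Rightarrow> real" where
  "add_fun u h = (\<lambda>t\<in>{a..b}. u t + h t)"

definition remainder :: "((real \<Rightarrow> real) \<times> real \<Rightarrow> real set \<Rightarrow> real) \<Rightarrow> (real \<Rightarrow> real) \<Rightarrow> (real \<Rightarrow> real) \<Rightarrow> real \<Rightarrow> real" where
  "remainder \<mu> u h t = running_max a (add_fun u h) t - running_max a u t - pairing a b (\<mu> (add_fun u h, t)) h"

lemma add_fun_apply: "t \<in> {a..b} \<Longrightarrow> add_fun u h t = u t + h t"
  by (simp add: add_fun_def)

lemma add_fun_C_space: "u \<in> C_space a b \<Longrightarrow> h \<in> C_space a b \<Longrightarrow> add_fun u h \<in> C_space a b"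
  unfolding add_fun_def by (rule C_space_add)

lemma selector_max_subdiff:
  "\<mu> \<in> measurable_selectors a b \<Longrightarrow> u \<in> C_space a b \<Longrightarrow> t \<in> {a..b} \<Longrightarrow> \<mu> (u, t) \<in> max_subdiff a b u t"
  by (simp add: measurable_selectors_def)

lemma running_max_measurable:
  "u \<in> C_space a b \<Longrightarrow> running_max a u \<in> borel_measurable (lebesgue_on {a<..<b})"
  by (intro measurable_Ioo_if_continuous continuous_on_running_max)

lemma remainder_measurable:
  assumes "\<mu> \<in> measurable_selectors a b" "u \<in> C_space a b" "h \<in> C_space a b"
  shows "remainder \<mu> u h \<in> borel_measurable (lebesgue_on {a<..<b})"
  unfolding remainder_def[abs_def]
  by (rule borel_measurable_diff[OF borel_measurable_diff[OF running_max_measurable running_max_measurable]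
        selector_pairing_measurable])
    (use assms add_fun_C_space in auto)

lemma remainder_le_gap':
  assumes "\<mu> \<in> measurable_selectors a b" "u \<in> C_space a b" "h \<in> C_space a b" "t \<in> {a..b}"
    and "\<And>\<tau>. \<tau> \<in> maximizers a (add_fun u h) t \<Longrightarrow> running_max a u t - u \<tau> \<le> c"
  shows "\<bar>remainder \<mu> u h t\<bar> \<le> c"
  unfolding remainder_def
  by (rule remainder_le_gap[OF assms(2,3) add_fun_C_space[OF assms(2,3)] add_fun_apply assms(4)
        selector_max_subdiff[OF assms(1) add_fun_C_space[OF assms(2,3)] assms(4)] assms(5)])

lemma gap_le_increment':
  assumes "u \<in> C_space a b" "h \<in> C_space a b" "t \<in> {a..b}"
    "\<tau> \<in> maximizers a (add_fun u h) t" "\<sigma> \<in> maximizers a u t"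
  shows "running_max a u t - u \<tau> \<le> h \<tau> - h \<sigma>"
  by (rule gap_le_increment[OF assms(1) add_fun_C_space[OF assms(1,2)] add_fun_apply assms(3-5)])

text \<open>Any maximizer of \<open>u\<close> serves for comparison, since no two points are farther
  apart than \<open>b - a\<close>. This supplies the majorant for dominated convergence and the
  constant independent of \<open>u\<close>.\<close>

lemma remainder_bound:
  assumes \<mu>: "\<mu> \<in> measurable_selectors a b" and u: "u \<in> C_space a b" and h: "h \<in> H" and t: "t \<in> {a..b}"
  shows "\<bar>remainder \<mu> u h t\<bar> \<le> hnorm h * (b - a) powr \<alpha>"
proof (rule remainder_le_gap'[OF \<mu> u hoelder_C_space[OF h] t])
  fix \<tau> assume \<tau>: "\<tau> \<in> maximizers a (add_fun u h) t"
  obtain \<sigma> where \<sigma>: "\<sigma> \<in> maximizers a u t" using maximizers_nonempty[OF u t] by blast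
  have in_ab: "\<tau> \<in> {a..b}" "\<sigma> \<in> {a..b}" using \<tau> \<sigma> t by (auto simp: maximizers_def)
  have "running_max a u t - u \<tau> \<le> h \<tau> - h \<sigma>"
    by (rule gap_le_increment'[OF u hoelder_C_space[OF h] t \<tau> \<sigma>])
  also have "\<dots> \<le> hnorm h * \<bar>\<tau> - \<sigma>\<bar> powr \<alpha>"
    using hoelder_quotient_le[OF h in_ab(2,1)] by linarith
  also have "\<dots> \<le> hnorm h * (b - a) powr \<alpha>"
    using in_ab \<alpha> by (intro mult_left_mono powr_mono2 hoelder_norm_bounds(1)[OF ab h]) auto
  finally show "running_max a u t - u \<tau> \<le> hnorm h * (b - a) powr \<alpha>" .
qed

text \<open>\<open>d\<close> depends on neither the selector nor \<open>h\<close>, as the supremum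
  over all of them requires. The estimate is used twice: an arbitrary maximizer shows that the gap
  is small, hence some maximizer lies near \<tau>, and comparing with that one gives the small
  factor.\<close>

lemma remainder_small:
  assumes u: "u \<in> C_space a b" and t: "t \<in> {a..b}" and "0 < e"
  obtains d where "0 < d" "\<And>\<mu> h. \<mu> \<in> measurable_selectors a b \<Longrightarrow> h \<in> H \<Longrightarrow> max_norm a b h < d \<Longrightarrow>
    \<bar>remainder \<mu> u h t\<bar> \<le> hnorm h * e"
proof -
  define r where "r = e powr (1 / \<alpha>)"
  have r: "r > 0" "r powr \<alpha> = e" using \<open>0 < e\<close> \<alpha> by (auto simp: r_def powr_powr)
  obtain d where d: "0 < d"
    "\<And>\<tau>. \<tau> \<in> {a..t} \<Longrightarrow> running_max a u t - u \<tau> < d \<Longrightarrow> \<exists>\<sigma>\<in>maximizers a u t. \<bar>\<tau> - \<sigma>\<bar> < r"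
    using maximizers_near[OF u t r(1)] by blast
  show ?thesis
  \<comment> \<open>The gap is at most a difference of two values of \<open>h\<close>, that is,
    twice the maximum norm.\<close>
  proof (rule that[of "d / 2"])
    fix \<mu> h assume \<mu>: "\<mu> \<in> measurable_selectors a b" and h: "h \<in> H" and small: "max_norm a b h < d / 2"
    show "\<bar>remainder \<mu> u h t\<bar> \<le> hnorm h * e"
    proof (rule remainder_le_gap'[OF \<mu> u hoelder_C_space[OF h] t])
      fix \<tau> assume \<tau>: "\<tau> \<in> maximizers a (add_fun u h) t"
      note gap = gap_le_increment'[OF u hoelder_C_space[OF h] t \<tau>]
      note mx = max_norm_bounds[OF hoelder_C_space[OF h]]
      obtain \<sigma>0 where \<sigma>0: "\<sigma>0 \<in> maximizers a u t" using maximizers_nonempty[OF u t] by blast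
      have "\<tau> \<in> {a..b}" "\<sigma>0 \<in> {a..b}" using \<tau> \<sigma>0 t by (auto simp: maximizers_def)
      then have "running_max a u t - u \<tau> < d"
        using gap[OF \<sigma>0] mx[of \<tau>] mx[of \<sigma>0] small by linarith
      then obtain \<sigma> where \<sigma>: "\<sigma> \<in> maximizers a u t" "\<bar>\<tau> - \<sigma>\<bar> < r"
        using d(2)[of \<tau>] \<tau> by (auto simp: maximizers_def)
      have \<sigma>_ab: "\<sigma> \<in> {a..b}" using \<sigma> t by (auto simp: maximizers_def)
      have "running_max a u t - u \<tau> \<le> hnorm h * \<bar>\<tau> - \<sigma>\<bar> powr \<alpha>"
        using gap[OF \<sigma>(1)] hoelder_quotient_le[OF h \<sigma>_ab \<open>\<tau> \<in> {a..b}\<close>] by linarith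
      also have "\<dots> \<le> hnorm h * r powr \<alpha>"
        using \<sigma>(2) \<alpha> by (intro mult_left_mono powr_mono2 hoelder_norm_bounds(1)[OF ab h]) auto
      finally show "running_max a u t - u \<tau> \<le> hnorm h * e" by (simp add: r)
    qed
  qed (use d in simp)
qed

abbreviation "snorm \<equiv> Lp_seminorm a b (ereal q)"
abbreviation "B \<equiv> (b - a) powr \<alpha> * (b - a) powr (1 / q)"

lemma remainder_seminorm_bound:
  assumes "\<mu> \<in> measurable_selectors a b" "u \<in> C_space a b" "h \<in> H"
  shows "snorm (remainder \<mu> u h) \<le> B * hnorm h"
proof -
  have "snorm (remainder \<mu> u h) \<le> (hnorm h * (b - a) powr \<alpha>) * (b - a) powr (1 / q)"
    using remainder_bound[OF assms]
    by (intro Lp_seminorm_le_if_bounded ab q remainder_measurable[OF assms(1,2) hoelder_C_space[OF assms(3)]]) auto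
  then show ?thesis by (simp add: mult_ac)
qed

text \<open>The pointwise threshold varies with \<open>t\<close>, so a violation along a sequence is
  assumed instead. The normalized remainders \<open>g n\<close> are uniformly bounded and tend to 0
  pointwise, hence in the seminorm, yet each has seminorm above \<open>e\<close>.\<close>

lemma remainder_seminorm_small:
  assumes u: "u \<in> C_space a b" and "0 < e"
  obtains d where "0 < d" "\<And>\<mu> h. \<mu> \<in> measurable_selectors a b \<Longrightarrow> h \<in> H \<Longrightarrow> 0 < hnorm h \<Longrightarrow>
    max_norm a b h \<le> d \<Longrightarrow> snorm (remainder \<mu> u h) \<le> e * hnorm h"
proof (rule ccontr)
  let ?M = "lebesgue_on {a<..<b}"
  assume "\<not> thesis"
  then have "\<exists>\<mu> h. \<mu> \<in> measurable_selectors a b \<and> h \<in> H \<and> 0 < hnorm h \<and>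
    max_norm a b h \<le> inverse (real (Suc n)) \<and> e * hnorm h < snorm (remainder \<mu> u h)" for n
    using that[of "inverse (real (Suc n))"] by (force simp: not_le)
  then obtain \<mu> h where mh: "\<And>n. \<mu> n \<in> measurable_selectors a b" "\<And>n. h n \<in> H" "\<And>n. 0 < hnorm (h n)"
    "\<And>n. max_norm a b (h n) \<le> inverse (real (Suc n))" "\<And>n. e * hnorm (h n) < snorm (remainder (\<mu> n) u (h n))"
    by metis
  define g where "g n t = remainder (\<mu> n) u (h n) t / hnorm (h n)" for n t
  have g_meas: "g n \<in> borel_measurable ?M" for n
    unfolding g_def using remainder_measurable[OF mh(1) u hoelder_C_space[OF mh(2)]] by simp
  have g_bound: "\<bar>g n t\<bar> \<le> (b - a) powr \<alpha>" if "t \<in> {a<..<b}" for n t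
    using remainder_bound[OF mh(1) u mh(2), of t n n] mh(3)[of n] that
    by (simp add: g_def divide_le_eq mult.commute)
  have g_lim: "(\<lambda>n. g n t) \<longlonglongrightarrow> 0" if t: "t \<in> {a<..<b}" for t
  proof (rule LIMSEQ_I)
    fix r :: real assume "r > 0"
    have t': "t \<in> {a..b}" using t by auto
    obtain d where d: "0 < d" "\<And>\<mu> h. \<mu> \<in> measurable_selectors a b \<Longrightarrow> h \<in> H \<Longrightarrow> max_norm a b h < d \<Longrightarrow>
      \<bar>remainder \<mu> u h t\<bar> \<le> hnorm h * (r / 2)"
      using remainder_small[OF u t', of "r / 2"] \<open>r > 0\<close> by auto
    obtain N where N: "inverse (real (Suc N)) < d" using reals_Archimedean[OF d(1)] by blast
    have "norm (g n t - 0) < r" if "n \<ge> N" for n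
    proof -
      have "inverse (real (Suc n)) \<le> inverse (real (Suc N))" using that by (intro le_imp_inverse_le) auto
      then have "max_norm a b (h n) < d" using mh(4)[of n] N by linarith
      then have "\<bar>remainder (\<mu> n) u (h n) t\<bar> \<le> hnorm (h n) * (r / 2)" by (rule d(2)[OF mh(1,2)])
      then have "\<bar>g n t\<bar> \<le> r / 2" using mh(3)[of n] by (simp add: g_def divide_le_eq mult.commute)
      then show ?thesis using \<open>r > 0\<close> by simp
    qed
    then show "\<exists>no. \<forall>n\<ge>no. norm (g n t - 0) < r" by blast
  qed
  have "(\<lambda>n. LINT t|?M. \<bar>g n t\<bar> powr q) \<longlonglongrightarrow> (LINT t|?M. 0)"
  proof (rule integral_dominated_convergence[where w = "\<lambda>_. ((b - a) powr \<alpha>) powr q"])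
    show "(\<lambda>t. \<bar>g n t\<bar> powr q) \<in> borel_measurable ?M" for n using g_meas by simp
    show "AE t in ?M. (\<lambda>n. \<bar>g n t\<bar> powr q) \<longlonglongrightarrow> 0"
    proof (rule AE_I2)
      fix t assume "t \<in> space ?M"
      then have "(\<lambda>n. \<bar>g n t\<bar>) \<longlonglongrightarrow> 0" using g_lim[of t] by (intro tendsto_rabs_zero) auto
      then show "(\<lambda>n. \<bar>g n t\<bar> powr q) \<longlonglongrightarrow> 0"
        \<comment> \<open>The base tends to 0, where the power is continuous only because the
          exponent is positive and the base nonnegative.\<close>
        using tendsto_powr'[OF _ tendsto_const[of q], of "\<lambda>n. \<bar>g n t\<bar>" 0] q by simp
    qed
    show "AE t in ?M. norm (\<bar>g n t\<bar> powr q) \<le> ((b - a) powr \<alpha>) powr q" for n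
      using g_bound q by (intro AE_I2) (auto intro!: powr_mono2)
  qed (auto intro: finite_measure.integrable_const[OF finite_measure_Ioo])
  then have "(\<lambda>n. (LINT t|?M. \<bar>g n t\<bar> powr q) powr (1 / q)) \<longlonglongrightarrow> 0"
    using tendsto_powr'[OF _ tendsto_const[of "1 / q"], of "\<lambda>n. LINT t|?M. \<bar>g n t\<bar> powr q" 0] q by simp
  then have "(\<lambda>n. snorm (g n)) \<longlonglongrightarrow> 0" by (simp add: Lp_seminorm_def)
  moreover have "e < snorm (g n)" for n
    using mh(3)[of n] mh(5)[of n] Lp_seminorm_divide[OF mh(3)[of n] q, of a b "remainder (\<mu> n) u (h n)"]
    by (simp add: g_def[abs_def] less_divide_eq)
  ultimately have "e \<le> 0" using LIMSEQ_le_const[of "\<lambda>n. snorm (g n)" 0 e] less_imp_le by blast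
  then show False using \<open>0 < e\<close> by simp
qed

text \<open>Taking the supremum over all admissible quotients, rather than the \<open>L\<^sup>q\<close> norm of a pointwise
  modulus, avoids any question of measurability of that modulus in \<open>t\<close>.\<close>

definition quotients :: "(real \<Rightarrow> real) \<Rightarrow> real \<Rightarrow> real set" where
  "quotients u d = {snorm (remainder \<mu> u h) / hnorm h | \<mu> h. \<mu> \<in> measurable_selectors a b \<and>
     h \<in> H \<and> 0 < hnorm h \<and> max_norm a b h \<le> d}"

text \<open>No quotient is admissible for \<open>d \<le> 0\<close>, since \<open>h\<close> then
  vanishes or cannot exist; inserting 0 keeps the set nonempty and the supremum nonnegative.\<close>

definition modulus :: "(real \<Rightarrow> real) \<Rightarrow> real \<Rightarrow> real" where
  "modulus u d = Sup (insert 0 (quotients u d))"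

lemma quotients_le:
  assumes "u \<in> C_space a b" "x \<in> quotients u d"
  shows "x \<le> B"
  using assms remainder_seminorm_bound by (auto simp: quotients_def divide_le_eq)

lemma bdd_above_quotients: "u \<in> C_space a b \<Longrightarrow> bdd_above (insert 0 (quotients u d))"
  using quotients_le[of u] by (intro bdd_aboveI[of _ B]) auto

lemma modulus_le:
  assumes "\<And>x. x \<in> quotients u d \<Longrightarrow> x \<le> K" "0 \<le> K"
  shows "modulus u d \<le> K"
  unfolding modulus_def using assms by (intro cSup_least) auto

lemma modulus_nonneg: "u \<in> C_space a b \<Longrightarrow> 0 \<le> modulus u d"
  unfolding modulus_def by (intro cSup_upper bdd_above_quotients) auto

lemma quotients_mono: "d \<le> d' \<Longrightarrow> quotients u d \<subseteq> quotients u d'"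
  unfolding quotients_def by (blast intro: order_trans)

lemma modulus_mono: "u \<in> C_space a b \<Longrightarrow> d \<le> d' \<Longrightarrow> modulus u d \<le> modulus u d'"
  unfolding modulus_def by (intro cSup_subset_mono bdd_above_quotients insert_mono) (auto intro: subsetD[OF quotients_mono])

lemma modulus_tendsto:
  assumes u: "u \<in> C_space a b"
  shows "(modulus u \<longlongrightarrow> 0) (at_right 0)"
proof (rule tendstoI)
  fix e :: real assume "e > 0"
  then have "e / 2 > 0" by simp
  then obtain d where d: "0 < d" "\<And>\<mu> h. \<mu> \<in> measurable_selectors a b \<Longrightarrow> h \<in> H \<Longrightarrow> 0 < hnorm h \<Longrightarrow>
    max_norm a b h \<le> d \<Longrightarrow> snorm (remainder \<mu> u h) \<le> e / 2 * hnorm h"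
    using remainder_seminorm_small[OF u] by metis
  \<comment> \<open>By monotonicity a bound at this single \<open>d\<close> holds at all smaller
    arguments.\<close>
  have "modulus u d \<le> e / 2"
    using d(2) \<open>e > 0\<close> by (intro modulus_le) (auto simp: quotients_def divide_le_eq)
  then have "dist (modulus u x) 0 < e" if "0 < x" "x < d" for x
    using modulus_mono[OF u, of x d] modulus_nonneg[OF u, of x] that \<open>e > 0\<close> by simp
  then show "\<forall>\<^sub>F x in at_right 0. dist (modulus u x) 0 < e"
    using d(1) unfolding eventually_at_right_field by blast
qed

lemma remainder_le_modulus:
  assumes \<mu>: "\<mu> \<in> measurable_selectors a b" and u: "u \<in> C_space a b" and h: "h \<in> H"
  shows "snorm (remainder \<mu> u h) \<le> modulus u (max_norm a b h) * hnorm h"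
proof (cases "hnorm h > 0")
  case True
  have "snorm (remainder \<mu> u h) / hnorm h \<le> modulus u (max_norm a b h)"
    unfolding modulus_def using assms True
    by (intro cSup_upper bdd_above_quotients u) (auto simp: quotients_def)
  then show ?thesis using True by (simp add: divide_le_eq)
next
  case False
  \<comment> \<open>Such an \<open>h\<close> contributes no quotient, but the crude bound already
    forces the remainder to have seminorm at most 0.\<close>
  then have "hnorm h = 0" using hoelder_norm_bounds(1)[OF ab h] by simp
  then show ?thesis using remainder_seminorm_bound[OF assms] by simp
qed

end

section \<open>The functionals given by the measures, and the Newton derivative\<close>

lemma pairing_add:
  assumes \<nu>: "\<nu> \<in> max_subdiff a b u t" and h: "h \<in> C_space a b" and k: "k \<in> C_space a b"
  shows "pairing a b \<nu> (\<lambda>t\<in>{a..b}. h t + k t) = pairing a b \<nu> h + pairing a b \<nu> k"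
proof -
  let ?N = "as_measure a b \<nu>"
  have "(LINT s|?N. (\<lambda>t\<in>{a..b}. h t + k t) s) = (LINT s|?N. h s + k s)"
    by (intro Bochner_Integration.integral_cong) auto
  also have "\<dots> = (LINT s|?N. h s) + (LINT s|?N. k s)"
    by (intro Bochner_Integration.integral_add max_subdiff_integrable[OF \<nu>] h k)
  finally show ?thesis by (simp add: max_subdiff_pairing[OF \<nu>])
qed

lemma pairing_scale:
  assumes \<nu>: "\<nu> \<in> max_subdiff a b u t"
  shows "pairing a b \<nu> (\<lambda>t\<in>{a..b}. c * h t) = c * pairing a b \<nu> h"
proof -
  let ?N = "as_measure a b \<nu>"
  have "(LINT s|?N. (\<lambda>t\<in>{a..b}. c * h t) s) = (LINT s|?N. c * h s)"
    by (intro Bochner_Integration.integral_cong) auto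
  then show ?thesis by (simp add: max_subdiff_pairing[OF \<nu>])
qed

lemma abs_pairing_le_max_norm:
  assumes \<nu>: "\<nu> \<in> max_subdiff a b u t" and h: "h \<in> C_space a b"
  shows "\<bar>pairing a b \<nu> h\<bar> \<le> max_norm a b h"
proof -
  let ?N = "as_measure a b \<nu>"
  interpret prob_space ?N by (rule max_subdiff_prob_space[OF \<nu>])
  note int = max_subdiff_integrable[OF \<nu> h]
  have "\<bar>expectation h\<bar> \<le> expectation (\<lambda>s. \<bar>h s\<bar>)" by (rule integral_abs_bound)
  also have "\<dots> \<le> max_norm a b h"
    using int max_norm_bounds[OF h] by (intro integral_le_const) (auto intro!: AE_I2)
  finally show ?thesis by (simp add: max_subdiff_pairing[OF \<nu>])
qed

text \<open>Treats both families of spaces at once. Domination of the Hoelder norm is enough,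
  because the remainder estimate only weakens when its norm factor is replaced by a larger
  one.\<close>

locale hoelder_subspace = hoelder_setting +
  fixes X :: "(real \<Rightarrow> real) normed_sp"
  assumes carrier_subset: "nsp_carrier X \<subseteq> nsp_carrier (hoelder_space a b \<alpha>)"
    and add_eq: "nsp_add X = (\<lambda>u v. \<lambda>t\<in>{a..b}. u t + v t)"
    and scale_eq: "nsp_scale X = (\<lambda>c u. \<lambda>t\<in>{a..b}. c * u t)"
    and add_closed: "\<And>u v. u \<in> nsp_carrier X \<Longrightarrow> v \<in> nsp_carrier X \<Longrightarrow> nsp_add X u v \<in> nsp_carrier X"
    and scale_closed: "\<And>c u. u \<in> nsp_carrier X \<Longrightarrow> nsp_scale X c u \<in> nsp_carrier X"
    and norm_le: "\<And>u. u \<in> nsp_carrier X \<Longrightarrow> nsp_norm (hoelder_space a b \<alpha>) u \<le> nsp_norm X u"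
begin

abbreviation "E \<equiv> nsp_carrier X"
abbreviation "Y \<equiv> Lp_space a b (ereal q)"

lemma E_C_space: "u \<in> E \<Longrightarrow> u \<in> C_space a b"
  using carrier_subset hoelder_C_space by blast

lemma max_norm_le_norm:
  assumes "h \<in> E"
  shows "max_norm a b h \<le> (1 + (b - a) powr \<alpha>) * nsp_norm X h"
proof -
  have "max_norm a b h \<le> (1 + (b - a) powr \<alpha>) * hnorm h"
    using assms carrier_subset \<alpha> by (intro max_norm_le_hoelder_norm[OF ab]) auto
  also have "\<dots> \<le> (1 + (b - a) powr \<alpha>) * nsp_norm X h"
    using norm_le[OF assms] by (intro mult_left_mono) (auto intro: add_nonneg_nonneg)
  finally show ?thesis .
qed

text \<open>The differences of classes collapse to the class of the pointwise
  \<open>remainder\<close>, whose Hoelder estimate is then weakened to the norm of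
  \<open>X\<close>.\<close>

lemma remainder_estimate:
  assumes u: "u \<in> E" and h: "h \<in> E" and L: "L \<in> cumulated_max_deriv a b X (nsp_add X u h)"
  shows "nsp_norm Y (nsp_diff Y (nsp_diff Y (cumulated_max a b (nsp_add X u h)) (cumulated_max a b u)) (L h))
    \<le> modulus u (max_norm a b h) * nsp_norm X h"
proof -
  have uh: "nsp_add X u h = add_fun u h" by (simp add: add_eq add_fun_def)
  obtain \<mu> where \<mu>: "\<mu> \<in> measurable_selectors a b"
    and L_eq: "L = (\<lambda>k\<in>E. Lp_class a b (\<lambda>t. pairing a b (\<mu> (add_fun u h, t)) k))"
    using L unfolding cumulated_max_deriv_def uh by blast
  note C = E_C_space[OF u] E_C_space[OF h]
  have "nsp_diff Y (nsp_diff Y (cumulated_max a b (add_fun u h)) (cumulated_max a b u)) (L h)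
      = Lp_class a b (remainder \<mu> u h)"
    unfolding cumulated_max_def
    using h by (simp add: L_eq nsp_diff_Lp_class remainder_def[abs_def] borel_measurable_diff running_max_measurable
        add_fun_C_space selector_pairing_measurable[OF \<mu>] C)
  then have "nsp_norm Y (nsp_diff Y (nsp_diff Y (cumulated_max a b (add_fun u h)) (cumulated_max a b u)) (L h))
      = snorm (remainder \<mu> u h)"
    by (simp add: nsp_norm_Lp_class remainder_measurable \<mu> C)
  also have "\<dots> \<le> modulus u (max_norm a b h) * hnorm h"
    using h carrier_subset by (intro remainder_le_modulus \<mu> C) auto
  also have "\<dots> \<le> modulus u (max_norm a b h) * nsp_norm X h"
    by (intro mult_left_mono norm_le h modulus_nonneg C)
  finally show ?thesis by (simp add: uh)
qed

lemma cumulated_max_in_carrier: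
  assumes "u \<in> C_space a b"
  shows "cumulated_max a b u \<in> nsp_carrier Y"
  unfolding cumulated_max_def
proof (intro Lp_class_in_carrier Lp_functions_if_bounded[OF ab])
  show "\<bar>running_max a u t\<bar> \<le> max_norm a b u" if "t \<in> {a<..<b}" for t
  proof -
    have t: "t \<in> {a..b}" using that by auto
    obtain \<tau> where "\<tau> \<in> {a..t}" "u \<tau> = running_max a u t" using running_max_attained[OF assms t] by blast
    then show ?thesis using max_norm_bounds[OF assms, of \<tau>] t by auto
  qed
qed (use assms q running_max_measurable in auto)

lemma cumulated_max_deriv_continuous_linear:
  assumes u: "u \<in> E"
  shows "cumulated_max_deriv a b X u \<subseteq> cont_linear_maps X Y"
proof
  fix L assume "L \<in> cumulated_max_deriv a b X u"
  then obtain \<mu> where \<mu>: "\<mu> \<in> measurable_selectors a b"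
    and L: "L = (\<lambda>h\<in>E. Lp_class a b (\<lambda>t. pairing a b (\<mu> (u, t)) h))"
    unfolding cumulated_max_deriv_def by blast
  let ?l = "\<lambda>h t. pairing a b (\<mu> (u, t)) h"
  note \<nu> = selector_max_subdiff[OF \<mu> E_C_space[OF u]]
  have meas: "?l h \<in> borel_measurable (lebesgue_on {a<..<b})" if "h \<in> E" for h
    using that by (intro selector_pairing_measurable \<mu> E_C_space u)
  have bound: "\<bar>?l h t\<bar> \<le> max_norm a b h" if "h \<in> E" "t \<in> {a<..<b}" for h t
    using that by (intro abs_pairing_le_max_norm[OF \<nu>] E_C_space) auto
  show "L \<in> cont_linear_maps X Y"
    unfolding cont_linear_maps_def
  proof (intro CollectI conjI ballI allI)
    have "Lp_class a b (?l h) \<in> nsp_carrier Y" if "h \<in> E" for h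
      using q by (intro Lp_class_in_carrier Lp_functions_if_bounded[OF ab _ meas bound] that) simp_all
    then show "L \<in> E \<rightarrow>\<^sub>E nsp_carrier Y" by (simp add: L)
    show "L (nsp_add X x y) = nsp_add Y (L x) (L y)" if x: "x \<in> E" and y: "y \<in> E" for x y
    proof -
      have "Lp_class a b (?l (nsp_add X x y)) = Lp_class a b (\<lambda>t. ?l x t + ?l y t)"
        by (intro Lp_class_cong_on meas add_closed x y)
          (simp add: add_eq pairing_add[OF \<nu> E_C_space E_C_space] x y)
      then show ?thesis by (simp add: L x y add_closed nsp_add_Lp_class meas)
    qed
    show "L (nsp_scale X c x) = nsp_scale Y c (L x)" if x: "x \<in> E" for c x
    proof -
      have "Lp_class a b (?l (nsp_scale X c x)) = Lp_class a b (\<lambda>t. c * ?l x t)"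
        by (intro Lp_class_cong_on meas scale_closed x) (simp add: scale_eq pairing_scale[OF \<nu>])
      then show ?thesis by (simp add: L x scale_closed nsp_scale_Lp_class meas)
    qed
    \<comment> \<open>The constant of the embedding into the continuous functions times the norm of
      the constant function 1 in the target space.\<close>
    let ?K = "(1 + (b - a) powr \<alpha>) * (b - a) powr (1 / q)"
    have "nsp_norm Y (L x) \<le> ?K * nsp_norm X x" if x: "x \<in> E" for x
    proof -
      have "nsp_norm Y (L x) = snorm (?l x)" by (simp add: L x nsp_norm_Lp_class meas)
      also have "\<dots> \<le> max_norm a b x * (b - a) powr (1 / q)"
        by (intro Lp_seminorm_le_if_bounded ab q meas bound x)
      also have "\<dots> \<le> (1 + (b - a) powr \<alpha>) * nsp_norm X x * (b - a) powr (1 / q)"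
        by (intro mult_right_mono max_norm_le_norm x) simp
      finally show ?thesis by (simp add: mult_ac)
    qed
    then show "\<exists>K. \<forall>x\<in>E. nsp_norm Y (L x) \<le> K * nsp_norm X x" by blast
  qed
qed

lemma newton_derivative_cumulated_max:
  "newton_derivative X Y E (cumulated_max a b) (cumulated_max_deriv a b X)"
  unfolding newton_derivative_def
proof (intro conjI ballI)
  show "nsp_open X E" unfolding nsp_open_def by (auto intro: exI[of _ 1])
  show "cumulated_max a b ` E \<subseteq> nsp_carrier Y"
    using cumulated_max_in_carrier E_C_space by blast
  fix u assume u: "u \<in> E"
  show "cumulated_max_deriv a b X u \<noteq> {}"
    unfolding cumulated_max_deriv_def using dirac_first_maximizer_selector[of a b] by blast
  show "cumulated_max_deriv a b X u \<subseteq> cont_linear_maps X Y"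
    by (rule cumulated_max_deriv_continuous_linear[OF u])
  let ?R = "\<lambda>h L. nsp_norm Y (nsp_diff Y (nsp_diff Y (cumulated_max a b (nsp_add X u h)) (cumulated_max a b u)) (L h))"
  \<comment> \<open>Converts the norm of \<open>X\<close> into the maximum norm, the argument of the
    modulus; being positive, it keeps this argument to the right of 0.\<close>
  let ?C = "1 + (b - a) powr \<alpha>"
  let ?F = "inf (filtercomap (nsp_norm X) (at_right 0)) (principal {h \<in> E. nsp_add X u h \<in> E})"
  have C: "?C > 0" by (intro add_pos_nonneg) auto
  have le: "(SUP L\<in>cumulated_max_deriv a b X (nsp_add X u h). ennreal (?R h L / nsp_norm X h))
      \<le> ennreal (modulus u (?C * nsp_norm X h))" if h: "h \<in> E" and pos: "0 < nsp_norm X h" for h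
  proof (intro SUP_least ennreal_leI)
    fix L assume "L \<in> cumulated_max_deriv a b X (nsp_add X u h)"
    then have "?R h L / nsp_norm X h \<le> modulus u (max_norm a b h)"
      using remainder_estimate[OF u h] pos by (simp add: divide_le_eq)
    also have "\<dots> \<le> modulus u (?C * nsp_norm X h)"
      by (intro modulus_mono E_C_space u max_norm_le_norm h)
    finally show "?R h L / nsp_norm X h \<le> modulus u (?C * nsp_norm X h)" .
  qed
  have norm_lim: "filterlim (nsp_norm X) (at_right 0) ?F"
    by (rule filterlim_mono[OF filterlim_filtercomap order_refl inf_le1])
  have "\<forall>\<^sub>F h in ?F. 0 < nsp_norm X h"
    using eventually_compose_filterlim[OF eventually_at_right_less norm_lim] .
  moreover have "\<forall>\<^sub>F h in ?F. h \<in> E" by (simp add: eventually_inf_principal)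
  ultimately have ev: "\<forall>\<^sub>F h in ?F. (SUP L\<in>cumulated_max_deriv a b X (nsp_add X u h). ennreal (?R h L / nsp_norm X h))
      \<le> ennreal (modulus u (?C * nsp_norm X h))"
    by eventually_elim (rule le)
  have "((\<lambda>h. modulus u (?C * nsp_norm X h)) \<longlongrightarrow> 0) ?F"
    by (rule filterlim_compose[OF modulus_tendsto[OF E_C_space[OF u]]], rule filterlim_times_pos[OF norm_lim C]) simp
  then have lim: "((\<lambda>h. ennreal (modulus u (?C * nsp_norm X h))) \<longlongrightarrow> 0) ?F"
    using tendsto_ennrealI by fastforce
  show "((\<lambda>h. SUP L\<in>cumulated_max_deriv a b X (nsp_add X u h). ennreal (?R h L / nsp_norm X h)) \<longlongrightarrow> 0) ?F"
    by (rule tendsto_sandwich[OF _ ev tendsto_const lim]) simp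
qed

lemma newton_derivative_with_modulus:
  "newton_derivative X Y E (cumulated_max a b) (cumulated_max_deriv a b X) \<and>
   (\<exists>(\<rho> :: (real \<Rightarrow> real) \<Rightarrow> real \<Rightarrow> real) (K :: real). \<forall>u\<in>E.
      mono_on {0..} (\<rho> u) \<and>
      (\<forall>\<delta>\<ge>0. 0 \<le> \<rho> u \<delta> \<and> \<rho> u \<delta> \<le> K) \<and>
      (\<rho> u \<longlongrightarrow> 0) (at_right 0) \<and>
      (\<forall>h\<in>E. \<forall>L\<in>cumulated_max_deriv a b X (nsp_add X u h).
         nsp_norm Y (nsp_diff Y (nsp_diff Y (cumulated_max a b (nsp_add X u h)) (cumulated_max a b u)) (L h))
         \<le> \<rho> u (max_norm a b h) * nsp_norm X h))"
\<comment> \<open>The bound \<open>B\<close> does not mention \<open>u\<close>, which is the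
  required independence.\<close>
proof (rule conjI[OF newton_derivative_cumulated_max], intro exI[of _ modulus] exI[of _ B] ballI conjI allI impI)
  fix u assume u: "u \<in> E"
  note uC = E_C_space[OF u]
  show "mono_on {0..} (modulus u)" by (intro mono_onI modulus_mono uC)
  show "(modulus u \<longlongrightarrow> 0) (at_right 0)" by (rule modulus_tendsto[OF uC])
  show "0 \<le> modulus u \<delta>" for \<delta> by (rule modulus_nonneg[OF uC])
  show "modulus u \<delta> \<le> B" for \<delta> by (rule modulus_le, erule quotients_le[OF uC]) simp
qed (rule remainder_estimate)

end

section \<open>The two families of spaces as instances\<close>

lemma hoelder_subspace_hoelder_space:
  assumes "a < b" "1 \<le> q" "0 < \<alpha>"
  shows "hoelder_subspace a b q \<alpha> (hoelder_space a b \<alpha>)"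
proof
  show "nsp_add (hoelder_space a b \<alpha>) = (\<lambda>u v. \<lambda>t\<in>{a..b}. u t + v t)"
    and "nsp_scale (hoelder_space a b \<alpha>) = (\<lambda>c u. \<lambda>t\<in>{a..b}. c * u t)"
    by (simp_all add: hoelder_space_def)
  then show "\<And>u v. u \<in> nsp_carrier (hoelder_space a b \<alpha>) \<Longrightarrow> v \<in> nsp_carrier (hoelder_space a b \<alpha>) \<Longrightarrow>
      nsp_add (hoelder_space a b \<alpha>) u v \<in> nsp_carrier (hoelder_space a b \<alpha>)"
    and "\<And>c u. u \<in> nsp_carrier (hoelder_space a b \<alpha>) \<Longrightarrow>
      nsp_scale (hoelder_space a b \<alpha>) c u \<in> nsp_carrier (hoelder_space a b \<alpha>)"
    using hoelder_space_add[OF assms(1)] hoelder_space_scale[OF assms(1)] by simp_all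
qed (use assms in auto)

lemma hoelder_subspace_sobolev_space:
  assumes "a < b" "1 \<le> q" "1 < p"
  shows "hoelder_subspace a b q (sobolev_exponent p) (sobolev_space a b p)"
proof
  show "nsp_add (sobolev_space a b p) = (\<lambda>u v. \<lambda>t\<in>{a..b}. u t + v t)"
    and "nsp_scale (sobolev_space a b p) = (\<lambda>c u. \<lambda>t\<in>{a..b}. c * u t)"
    by (simp_all add: sobolev_space_def)
  then show "\<And>u v. u \<in> nsp_carrier (sobolev_space a b p) \<Longrightarrow> v \<in> nsp_carrier (sobolev_space a b p) \<Longrightarrow>
      nsp_add (sobolev_space a b p) u v \<in> nsp_carrier (sobolev_space a b p)"
    and "\<And>c u. u \<in> nsp_carrier (sobolev_space a b p) \<Longrightarrow>
      nsp_scale (sobolev_space a b p) c u \<in> nsp_carrier (sobolev_space a b p)"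
    using sobolev_space_add[OF assms(1,3)] sobolev_space_scale[OF assms(1,3)] by simp_all
qed (use assms sobolev_space_subset_hoelder_space[OF assms(1,3)] sobolev_exponent_pos[OF assms(3)] in auto)

theorem proposition4p8:
  fixes a b q :: real and X :: "(real \<Rightarrow> real) normed_sp"
  assumes "a < b"
    and "1 \<le> q"
    and "(\<exists>\<alpha>::real. 0 < \<alpha> \<and> \<alpha> \<le> 1 \<and> X = hoelder_space a b \<alpha>) \<or>
         (\<exists>p::ereal. 1 < p \<and> X = sobolev_space a b p)"
  shows "newton_derivative X (Lp_space a b (ereal q)) (nsp_carrier X)
           (cumulated_max a b) (cumulated_max_deriv a b X) \<and>
         (\<exists>(\<rho> :: (real \<Rightarrow> real) \<Rightarrow> real \<Rightarrow> real) (K :: real). \<forall>u\<in>nsp_carrier X.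
            mono_on {0..} (\<rho> u) \<and>
            (\<forall>\<delta>\<ge>0. 0 \<le> \<rho> u \<delta> \<and> \<rho> u \<delta> \<le> K) \<and>
            (\<rho> u \<longlongrightarrow> 0) (at_right 0) \<and>
            (\<forall>h\<in>nsp_carrier X. \<forall>L\<in>cumulated_max_deriv a b X (nsp_add X u h).
               nsp_norm (Lp_space a b (ereal q))
                 (nsp_diff (Lp_space a b (ereal q))
                    (nsp_diff (Lp_space a b (ereal q))
                       (cumulated_max a b (nsp_add X u h)) (cumulated_max a b u))
                    (L h))
               \<le> \<rho> u (max_norm a b h) * nsp_norm X h))"
proof -
  \<comment> \<open>The exponent is the given one in the Hoelder case and
    \<open>sobolev_exponent p\<close> in the Sobolev case.\<close>
  obtain \<alpha> where "hoelder_subspace a b q \<alpha> X"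
    using assms(3) hoelder_subspace_hoelder_space[OF assms(1,2)] hoelder_subspace_sobolev_space[OF assms(1,2)]
    by blast
  then show ?thesis by (rule hoelder_subspace.newton_derivative_with_modulus)
qed

end
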